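(* Let $M$ be a locally compact Polish space with a positive, locally finite Borel measure $\mu$ of full topological support, and let $\{U_t:t\ge 0\}$ be a strongly continuous semigroup of bounded, positivity preserving linear operators on $L^2(M,\mu)$ with adjoint semigroup $\{U_t^*:t\ge 0\}$, both given for $t>0$ by a real-valued measurable kernel $u_t(x,y)$. Fix $t_0>0$ and assume: every $U_t$, $t>0$, is compact on $L^2(M,\mu)$; $U_{t_0}$ is positivity improving; both semigroups have the strong Feller property; and $U_{t_0},U_{t_0}^*:L^2(M,\mu)\to L^\infty(M,\mu)$ are bounded. Let $\lambda_0,\phi_0,\psi_0,\mathcal N,\gamma$ be as defined in the context. Suppose that there exists some $t_1\ge t_0$ such that the heat content is finite, i.e. $Z(t_1)<\infty$. Then: (a) $\phi_0,\psi_0\in L^1(M,\mu)$, so both probability measures $$m(E)=\frac{\int_E\psi_0\,d\mu}{\int_M\psi_0\,d\mu},\qquad m^*(E)=\frac{\int_E\phi_0\,d\mu}{\int_M\phi_0\,d\mu}$$ are well defined. (b) For every $p\in[1,\infty]$ there exists $C>0$ such that for every finite measure $\sigma$ on $M$ with $\operatorname{supp}\sigma\cap(M\setminus\mathcal N)\ne\emptyset$ and for all $t>6t_1$ and $t_1\le s\le t/2$, $$\sup_{f\in L^p(M,\mu),\ \|f\|_p\le 1}\left|\frac{\sigma(U_tf)}{\sigma(U_t\mathbf 1_M)}-m(f)\right|\le C\,e^{-\gamma(t-s)}\,\frac{e^{\lambda_0 s}\sigma(U_s\mathbf 1_M)}{\sigma(\phi_0)}$$ and $$\sup_{f\in L^p(M,\mu),\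 \|f\|_p\le 1}\left|\frac{\sigma(U_t^*f)}{\sigma(U_t^*\mathbf 1_M)}-m^*(f)\right|\le C\,e^{-\gamma(t-s)}\,\frac{e^{\lambda_0 s}\sigma(U_s^*\mathbf 1_M)}{\sigma(\psi_0)}.$$ (c) $m$ and $m^*$ are the unique quasi-stationary probability measures of $\{U_t\}$ and $\{U_t^*\}$, respectively, with $m(M\setminus\mathcal N)\cdot m^*(M\setminus\mathcal N)>0$; that is, $m,m^*$ are quasi-stationary with this property, and if $\bar m$, $\bar m^*$ are quasi-stationary probability measures of $\{U_t\}$, $\{U_t^*\}$, respectively, with $\bar m(M\setminus\mathcal N)\cdot\bar m^*(M\setminus\mathcal N)>0$, then $\bar m=m$ and $\bar m^*=m^*$.
   Context: Neither compactness of $M$ nor finiteness of $\mu$ is assumed. For a measure $\sigma$ write $\sigma(g)=\int g\,d\sigma$; $\mathbf 1_M$ is the constant function $1$; $\|\cdot\|_p$ is the $L^p(M,\mu)$ norm. Kernels: $U_tf(x)=\int u_t(x,y)f(y)\,\mu(dy)$ and $U_t^*g(y)=\int u_t(x,y)g(x)\,\mu(dx)$, $t>0$; these formulas also define $U_t,U_t^*$ on other $L^p$ spaces. Positivity preserving: $f\ge0$ a.e. implies $U_tf\ge 0$ a.e. Positivity improving: $f\ge 0$, $f\not\equiv 0$ in $L^2$ implies $U_{t_0}f>0$ $\mu$-a.e. Strong Feller property: for every $t>0$ and $f\in L^\infty(M,\mu)$ one has $U_tf,U_t^*f\in C_b(M)$ (bounded continuous). Under the assumptions $U_t,U_t^*$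 map $L^p(M,\mu)$ into $C_b(M)$ for all $t>2t_0$, $p\in[1,\infty]$; $U_tf$, $U_t^*f$ are always understood as these continuous functions. Ground states: with $A$ the generator of $\{U_t\}$ and $A^*$ that of $\{U_t^*\}$, $\lambda_0:=\inf\mathrm{Re}(\mathrm{Spec}(-A))=\inf\mathrm{Re}(\mathrm{Spec}(-A^* ))$ is a joint isolated simple eigenvalue of $-A$ and $-A^*$, with $L^2$-normalized, $\mu$-a.e. strictly positive eigenfunctions $\phi_0$ (of $-A$) and $\psi_0$ (of $-A^*$), so $U_t\phi_0=e^{-\lambda_0t}\phi_0$, $U_t^*\psi_0=e^{-\lambda_0t}\psi_0$; they have continuous bounded versions, which are used. Set $\Lambda:=\int\phi_0\psi_0\,d\mu$ and $\mathcal N:=\{\phi_0=0\}\cup\{\psi_0=0\}$ (a closed $\mu$-null set). The constant $\gamma$: under the assumptions there are constants $C_0,\gamma>0$ (known result) such that $|e^{\lambda_0t}u_t(x,y)-\Lambda^{-1}\phi_0(x)\psi_0(y)|\le C_0e^{-\gamma t}$ for all $t>2t_0$ and $\mu\otimes\mu$-a.a. $(x,y)$; such a $\gamma$ is fixed. Heat content: $Z(t):=\int U_t\mathbf 1_M\,d\mu=\int U_t^*\mathbf 1_M\,d\mu=\iint u_t(x,y)\,\mu(dx)\mu(dy)\in(0,\infty]$. Quasi-stationary measure: a probability measure $\bar m$ on the Borel sets of $M$ is quasi-stationary for $\{U_t\}$ if for all $t>0$ and $f\in L^\infty(M,\mu)$ we have $\bar m(U_t\mathbf 1_M)>0$ and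 $\bar m(U_tf)/\bar m(U_t\mathbf 1_M)=\bar m(f)$; analogously for $\{U_t^*\}$. *)

theory Defs
  imports "HOL-Probability.Probability"
begin

definition measure_support :: "'a::topological_space measure \<Rightarrow> 'a set" where
  "measure_support \<sigma> = {x. \<forall>U. open U \<longrightarrow> x \<in> U \<longrightarrow> 0 < emeasure \<sigma> U}"

definition locally_finite_measure :: "'a::topological_space measure \<Rightarrow> bool" where
  "locally_finite_measure \<mu> \<longleftrightarrow> (\<forall>x. \<exists>U. open U \<and> x \<in> U \<and> emeasure \<mu> U < \<infinity>)"

text \<open>
  Elements of $L^p(M,\mu)$ are represented by measurable functions; identities between them are
  stated almost everywhere. Exponents range over the extended nonnegative reals.
\<close>

definition Lp_norm :: "'a measure \<Rightarrow> ennreal \<Rightarrow> ('a \<Rightarrow> 'b::real_normed_vector) \<Rightarrow> ennreal" where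
  "Lp_norm \<mu> p f =
    (if p = \<infinity> then esssup \<mu> (\<lambda>x. ennreal (norm (f x)))
     else (let r = enn2real p; I = (\<integral>\<^sup>+x. ennreal (norm (f x) powr r) \<partial>\<mu>)
           in if I = \<infinity> then \<infinity> else ennreal (enn2real I powr (1 / r))))"

definition Lp :: "'a measure \<Rightarrow> ennreal \<Rightarrow> ('a \<Rightarrow> 'b::real_normed_vector) set" where
  "Lp \<mu> p = {f. f \<in> borel_measurable \<mu> \<and> Lp_norm \<mu> p f < \<infinity>}"

text \<open>
  The operators act on real-valued as well as on complex-valued functions. The spaces $L^p$ on
  which the semigroup is considered are the complex ones, because the spectrum of the generator
  is a set of complex numbers.
\<close>

definition kernel_op ::
  "'a measure \<Rightarrow> ('a \<Rightarrow> 'a \<Rightarrow> real) \<Rightarrow> ('a \<Rightarrow> 'b) \<Rightarrow> 'a \<Rightarrow> 'b::{banach, second_countable_topology}" where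
  "kernel_op \<mu> k f = (\<lambda>x. \<integral>y. k x y *\<^sub>R f y \<partial>\<mu>)"

text \<open>
  The Bochner integral is \<open>0\<close> for non-integrable functions, so that the existence of the integral
  has to be required separately.
\<close>

definition kernel_op_exists ::
  "'a measure \<Rightarrow> ('a \<Rightarrow> 'a \<Rightarrow> real) \<Rightarrow> ('a \<Rightarrow> 'b::{banach, second_countable_topology}) \<Rightarrow> bool" where
  "kernel_op_exists \<mu> k f \<longleftrightarrow> (AE x in \<mu>. integrable \<mu> (\<lambda>y. k x y *\<^sub>R f y))"

definition transposed :: "(real \<Rightarrow> 'a \<Rightarrow> 'a \<Rightarrow> real) \<Rightarrow> real \<Rightarrow> 'a \<Rightarrow> 'a \<Rightarrow> real" where
  "transposed u = (\<lambda>t x y. u t y x)"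

definition sg ::
  "'a measure \<Rightarrow> (real \<Rightarrow> 'a \<Rightarrow> 'a \<Rightarrow> real) \<Rightarrow> real
    \<Rightarrow> ('a \<Rightarrow> 'b) \<Rightarrow> 'a \<Rightarrow> 'b::{banach, second_countable_topology}" where
  "sg \<mu> u t f = (if t = 0 then f else kernel_op \<mu> (u t) f)"

text \<open>
  If \<open>\<mu>\<close> has full support, then there is at most one continuous function in each class modulo
  \<open>\<mu>\<close>-null sets. Wherever \<open>U\<^sub>t f\<close> has to be evaluated pointwise or integrated
  against a measure other than \<open>\<mu>\<close>, this continuous representative is used.
\<close>

definition cont_version :: "'a::topological_space measure \<Rightarrow> ('a \<Rightarrow> 'b::topological_space) \<Rightarrow> 'a \<Rightarrow> 'b" where
  "cont_version \<mu> g = (THE h. continuous_on UNIV h \<and> (AE x in \<mu>. h x = g x))"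

definition sg_cont ::
  "'a::topological_space measure \<Rightarrow> (real \<Rightarrow> 'a \<Rightarrow> 'a \<Rightarrow> real) \<Rightarrow> real
    \<Rightarrow> ('a \<Rightarrow> 'b) \<Rightarrow> 'a \<Rightarrow> 'b::{banach, second_countable_topology}" where
  "sg_cont \<mu> u t f = cont_version \<mu> (sg \<mu> u t f)"

definition bounded_L2_kernel :: "'a measure \<Rightarrow> ('a \<Rightarrow> 'a \<Rightarrow> real) \<Rightarrow> bool" where
  "bounded_L2_kernel \<mu> k \<longleftrightarrow>
    (\<forall>f \<in> (Lp \<mu> 2 :: ('a \<Rightarrow> complex) set). kernel_op_exists \<mu> k f \<and> kernel_op \<mu> k f \<in> Lp \<mu> 2) \<and>
    (\<exists>c::real. \<forall>f \<in> (Lp \<mu> 2 :: ('a \<Rightarrow> complex) set).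
       Lp_norm \<mu> 2 (kernel_op \<mu> k f) \<le> ennreal c * Lp_norm \<mu> 2 f)"

definition L2_semigroup :: "'a measure \<Rightarrow> (real \<Rightarrow> 'a \<Rightarrow> 'a \<Rightarrow> real) \<Rightarrow> bool" where
  "L2_semigroup \<mu> u \<longleftrightarrow>
    (\<forall>t>0. bounded_L2_kernel \<mu> (u t)) \<and>
    (\<forall>s>0. \<forall>t>0. \<forall>f \<in> (Lp \<mu> 2 :: ('a \<Rightarrow> complex) set).
       AE x in \<mu>. sg \<mu> u (s + t) f x = sg \<mu> u s (sg \<mu> u t f) x)"

definition strongly_continuous :: "'a measure \<Rightarrow> (real \<Rightarrow> 'a \<Rightarrow> 'a \<Rightarrow> real) \<Rightarrow> bool" where
  "strongly_continuous \<mu> u \<longleftrightarrow>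
    (\<forall>f \<in> (Lp \<mu> 2 :: ('a \<Rightarrow> complex) set). \<forall>s\<ge>0.
       ((\<lambda>t. Lp_norm \<mu> 2 (\<lambda>x. sg \<mu> u t f x - sg \<mu> u s f x)) \<longlongrightarrow> 0) (at s within {0..}))"

definition adjoint_semigroups ::
  "'a measure \<Rightarrow> (real \<Rightarrow> 'a \<Rightarrow> 'a \<Rightarrow> real) \<Rightarrow> (real \<Rightarrow> 'a \<Rightarrow> 'a \<Rightarrow> real) \<Rightarrow> bool" where
  "adjoint_semigroups \<mu> u v \<longleftrightarrow>
    (\<forall>t>0. \<forall>f \<in> (Lp \<mu> 2 :: ('a \<Rightarrow> complex) set). \<forall>g \<in> (Lp \<mu> 2 :: ('a \<Rightarrow> complex) set).
       (\<integral>x. sg \<mu> u t f x * cnj (g x) \<partial>\<mu>) = (\<integral>x. f x * cnj (sg \<mu> v t g x) \<partial>\<mu>))"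

definition compact_on_L2 :: "'a measure \<Rightarrow> (('a \<Rightarrow> complex) \<Rightarrow> ('a \<Rightarrow> complex)) \<Rightarrow> bool" where
  "compact_on_L2 \<mu> T \<longleftrightarrow>
    (\<forall>F :: nat \<Rightarrow> 'a \<Rightarrow> complex.
       (\<forall>n. F n \<in> Lp \<mu> 2 \<and> Lp_norm \<mu> 2 (F n) \<le> 1) \<longrightarrow>
       (\<exists>r. strict_mono r \<and>
          (\<exists>g \<in> Lp \<mu> 2. (\<lambda>n. Lp_norm \<mu> 2 (\<lambda>x. T (F (r n)) x - g x)) \<longlonglongrightarrow> 0)))"

definition positivity_preserving :: "'a measure \<Rightarrow> (real \<Rightarrow> 'a \<Rightarrow> 'a \<Rightarrow> real) \<Rightarrow> bool" where
  "positivity_preserving \<mu> u \<longleftrightarrow>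
    (\<forall>t>0. \<forall>f \<in> (Lp \<mu> 2 :: ('a \<Rightarrow> real) set).
       (AE x in \<mu>. 0 \<le> f x) \<longrightarrow> (AE x in \<mu>. 0 \<le> sg \<mu> u t f x))"

definition positivity_improving :: "'a measure \<Rightarrow> (('a \<Rightarrow> real) \<Rightarrow> ('a \<Rightarrow> real)) \<Rightarrow> bool" where
  "positivity_improving \<mu> T \<longleftrightarrow>
    (\<forall>f \<in> Lp \<mu> 2. (AE x in \<mu>. 0 \<le> f x) \<longrightarrow> \<not> (AE x in \<mu>. f x = 0) \<longrightarrow> (AE x in \<mu>. 0 < T f x))"

definition bounded_L2_Linfty :: "'a measure \<Rightarrow> (('a \<Rightarrow> complex) \<Rightarrow> ('a \<Rightarrow> complex)) \<Rightarrow> bool" where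
  "bounded_L2_Linfty \<mu> T \<longleftrightarrow>
    (\<exists>c::real. \<forall>f \<in> Lp \<mu> 2. Lp_norm \<mu> \<infinity> (T f) \<le> ennreal c * Lp_norm \<mu> 2 f)"

definition strong_Feller :: "'a::topological_space measure \<Rightarrow> (real \<Rightarrow> 'a \<Rightarrow> 'a \<Rightarrow> real) \<Rightarrow> bool" where
  "strong_Feller \<mu> u \<longleftrightarrow>
    (\<forall>t>0. \<forall>f \<in> (Lp \<mu> \<infinity> :: ('a \<Rightarrow> complex) set). kernel_op_exists \<mu> (u t) f \<and>
       (\<exists>h. continuous_on UNIV h \<and> bounded (range h) \<and> (AE x in \<mu>. h x = sg \<mu> u t f x)))"

text \<open>
  Unbounded operators on $L^2$ are represented by their graphs; the following is the graph of
  \<open>-A\<close>, where \<open>A\<close> is the generator.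
\<close>

definition neg_generator ::
  "'a measure \<Rightarrow> (real \<Rightarrow> 'a \<Rightarrow> 'a \<Rightarrow> real) \<Rightarrow> (('a \<Rightarrow> complex) \<times> ('a \<Rightarrow> complex)) set" where
  "neg_generator \<mu> u = {(f, g). f \<in> Lp \<mu> 2 \<and> g \<in> Lp \<mu> 2 \<and>
     ((\<lambda>h. Lp_norm \<mu> 2 (\<lambda>x. (1 / h) *\<^sub>R (f x - sg \<mu> u h f x) - g x)) \<longlongrightarrow> 0) (at_right 0)}"

text \<open>
  A number \<open>z\<close> belongs to the resolvent set of \<open>B\<close> iff \<open>B - z\<close> is a bijection from the domain of
  \<open>B\<close> onto $L^2$ with bounded inverse; the norm estimate contains the injectivity.
\<close>

definition resolvent_set ::
  "'a measure \<Rightarrow> (('a \<Rightarrow> complex) \<times> ('a \<Rightarrow> complex)) set \<Rightarrow> complex set" where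
  "resolvent_set \<mu> B = {z.
     (\<exists>c::real. \<forall>(f, g) \<in> B. Lp_norm \<mu> 2 f \<le> ennreal c * Lp_norm \<mu> 2 (\<lambda>x. g x - z * f x)) \<and>
     (\<forall>h \<in> Lp \<mu> 2. \<exists>(f, g) \<in> B. AE x in \<mu>. g x - z * f x = h x)}"

definition spectrum ::
  "'a measure \<Rightarrow> (('a \<Rightarrow> complex) \<times> ('a \<Rightarrow> complex)) set \<Rightarrow> complex set" where
  "spectrum \<mu> B = - resolvent_set \<mu> B"

definition spectral_bottom :: "'a measure \<Rightarrow> (real \<Rightarrow> 'a \<Rightarrow> 'a \<Rightarrow> real) \<Rightarrow> ereal" where
  "spectral_bottom \<mu> u = (INF z \<in> spectrum \<mu> (neg_generator \<mu> u). ereal (Re z))"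

definition ground_state ::
  "'a::topological_space measure \<Rightarrow> (real \<Rightarrow> 'a \<Rightarrow> 'a \<Rightarrow> real) \<Rightarrow> real \<Rightarrow> ('a \<Rightarrow> real) \<Rightarrow> bool" where
  "ground_state \<mu> u lam\<^sub>0 \<phi> \<longleftrightarrow>
    ((\<lambda>x. complex_of_real (\<phi> x)), (\<lambda>x. complex_of_real (lam\<^sub>0 * \<phi> x))) \<in> neg_generator \<mu> u \<and>
    Lp_norm \<mu> 2 \<phi> = 1 \<and> (AE x in \<mu>. 0 < \<phi> x) \<and>
    continuous_on UNIV \<phi> \<and> bounded (range \<phi>)"

definition nodal_set :: "('a \<Rightarrow> real) \<Rightarrow> ('a \<Rightarrow> real) \<Rightarrow> 'a set" where
  "nodal_set \<phi> \<psi> = {x. \<phi> x = 0} \<union> {x. \<psi> x = 0}"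

definition kernel_convergence_rate ::
  "'a measure \<Rightarrow> (real \<Rightarrow> 'a \<Rightarrow> 'a \<Rightarrow> real) \<Rightarrow> real \<Rightarrow> real \<Rightarrow> ('a \<Rightarrow> real) \<Rightarrow> ('a \<Rightarrow> real) \<Rightarrow> real \<Rightarrow> bool" where
  "kernel_convergence_rate \<mu> u t\<^sub>0 lam\<^sub>0 \<phi> \<psi> \<gamma> \<longleftrightarrow>
    (\<exists>C>0. \<forall>t>2 * t\<^sub>0. AE (x, y) in \<mu> \<Otimes>\<^sub>M \<mu>.
       \<bar>exp (lam\<^sub>0 * t) * u t x y - \<phi> x * \<psi> y / (\<integral>z. \<phi> z * \<psi> z \<partial>\<mu>)\<bar> \<le> C * exp (- \<gamma> * t))"

definition heat_content :: "'a measure \<Rightarrow> (real \<Rightarrow> 'a \<Rightarrow> 'a \<Rightarrow> real) \<Rightarrow> real \<Rightarrow> ennreal" where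
  "heat_content \<mu> u t = (\<integral>\<^sup>+x. ennreal (sg \<mu> u t (\<lambda>_. 1::real) x) \<partial>\<mu>)"

definition normalized_measure :: "'a measure \<Rightarrow> ('a \<Rightarrow> real) \<Rightarrow> 'a measure" where
  "normalized_measure \<mu> \<psi> = density \<mu> (\<lambda>x. ennreal (\<psi> x / (\<integral>y. \<psi> y \<partial>\<mu>)))"

text \<open>
  Since \<open>f\<close> ranges over all representatives, the identity below forces \<open>\<nu>\<close> to be
  absolutely continuous with respect to \<open>\<mu>\<close>, which is what makes the integral of \<open>f\<close> over \<open>\<nu>\<close>
  meaningful for classes \<open>f\<close> modulo \<open>\<mu>\<close>-null sets.
\<close>

definition quasi_stationary ::
  "'a::topological_space measure \<Rightarrow> (real \<Rightarrow> 'a \<Rightarrow> 'a \<Rightarrow> real) \<Rightarrow> 'a measure \<Rightarrow> bool" where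
  "quasi_stationary \<mu> u \<nu> \<longleftrightarrow>
    sets \<nu> = sets borel \<and> prob_space \<nu> \<and>
    (\<forall>t>0. \<forall>f \<in> (Lp \<mu> \<infinity> :: ('a \<Rightarrow> complex) set).
       0 < (\<integral>x. sg_cont \<mu> u t (\<lambda>_. 1::real) x \<partial>\<nu>) \<and>
       (\<integral>x. sg_cont \<mu> u t f x \<partial>\<nu>) / complex_of_real (\<integral>x. sg_cont \<mu> u t (\<lambda>_. 1) x \<partial>\<nu>)
         = (\<integral>x. f x \<partial>\<nu>))"

definition ergodic_deviation ::
  "'a::topological_space measure \<Rightarrow> (real \<Rightarrow> 'a \<Rightarrow> 'a \<Rightarrow> real) \<Rightarrow> ennreal
    \<Rightarrow> 'a measure \<Rightarrow> real \<Rightarrow> 'a measure \<Rightarrow> ereal" where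
  "ergodic_deviation \<mu> u p \<sigma> t m =
    (SUP f \<in> {f :: 'a \<Rightarrow> complex. f \<in> Lp \<mu> p \<and> Lp_norm \<mu> p f \<le> 1}.
       ereal (cmod ((\<integral>x. sg_cont \<mu> u t f x \<partial>\<sigma>)
           / complex_of_real (\<integral>x. sg_cont \<mu> u t (\<lambda>_. 1) x \<partial>\<sigma>)
         - (\<integral>x. f x \<partial>m))))"

end

theory Submission
  imports Defs
begin

text \<open>
  Everything rests on the convergence \<open>e\<^bsup>\<lambda>t\<^esup> u\<^sub>t(x, y) \<rightarrow> \<phi>(x) \<psi>(y) / \<Lambda>\<close>, which is uniform in \<open>(x, y)\<close> with exponential rate
  \<open>\<gamma>\<close>. It makes \<open>e\<^bsup>\<lambda>t\<^esup> U\<^sub>t\<close> converge to the projection onto the ground state as operators from $L^1$ to $L^\infty$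
  (\<open>L1_Linfty_rate\<close>), and it contains the eigenvalue equations \<open>U\<^sub>t \<phi> = e\<^bsup>-\<lambda>t\<^esup> \<phi>\<close> and \<open>U\<^sub>t\<^sup>* \<psi> = e\<^bsup>-\<lambda>t\<^esup> \<psi>\<close>
  (\<open>eigenfunction\<close>). The exponent \<open>\<lambda>\<close> appears as \<open>lam\<close> in the formal text.

  Finite heat content says that \<open>U\<^bsub>t\<^sub>1\<^esub> 1\<close> and \<open>U\<^sup>*\<^bsub>t\<^sub>1\<^esub> 1\<close> are integrable. Since \<open>\<phi> = e\<^bsup>\<lambda>t\<^sub>1\<^esup> U\<^bsub>t\<^sub>1\<^esub> \<phi>\<close> is dominated by a multiple of the
  former, \<open>\<phi>\<close> is integrable, and likewise \<open>\<psi>\<close>. Moreover \<open>U\<^sup>*\<^bsub>t\<^sub>1\<^esub> 1\<close> is bounded, which means by duality that \<open>U\<^bsub>t\<^sub>1\<^esub>\<close> maps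
  the unit ball of any $L^p$ boundedly into $L^1$ (\<open>Lp_L1_bound\<close>).

  For the ergodic estimate one factors \<open>U\<^sub>t = U\<^sub>s U\<^bsub>t-s-t\<^sub>1\<^esub> U\<^bsub>t\<^sub>1\<^esub>\<close>. The last factor leads from $L^p$ to $L^1$, and the middle one
  leads to $L^\infty$ with an error of order \<open>e\<^bsup>-\<gamma>(t-s)\<^esup>\<close>. The first factor is positive, so it turns a uniform error
  into a multiple of \<open>U\<^sub>s 1\<close>, and it gives continuous functions, so that the estimate holds at every point
  (\<open>pointwise_rate\<close>) and can be integrated against a measure \<open>\<sigma>\<close> which need not be absolutely continuous.
  The result says that \<open>e\<^bsup>\<lambda>t\<^esup> \<sigma>(U\<^sub>t f)\<close> is close to \<open>\<sigma>(\<phi>) \<psi>(f) / \<Lambda>\<close> for \<open>f\<close> as well as for the constant \<open>1\<close>; the quotient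
  is controlled because \<open>\<phi>\<close> is bounded, which bounds \<open>e\<^bsup>\<lambda>t\<^esup> \<sigma>(U\<^sub>t 1)\<close> below by a multiple of \<open>\<sigma>(\<phi>)\<close>
  (\<open>ergodic_deviation_bound\<close>).

  The measure \<open>\<psi>\<mu>\<close> is quasi-stationary because \<open>\<psi>\<close> is an eigenfunction of the dual semigroup. For a
  quasi-stationary \<open>\<nu>\<close> the quotient \<open>\<nu>(U\<^sub>t f) / \<nu>(U\<^sub>t 1)\<close> does not depend on \<open>t\<close>, and the ergodic estimate for \<open>\<sigma> = \<nu>\<close>
  identifies it with its limit (\<open>quasi_stationary_unique\<close>).
\<close>

section \<open>Lebesgue classes\<close>

lemma Lp_infinity_iff:
  fixes f :: "'a \<Rightarrow> 'b::real_normed_vector"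
  shows "f \<in> Lp \<mu> \<infinity> \<longleftrightarrow> f \<in> borel_measurable \<mu> \<and> (\<exists>B\<ge>0. AE x in \<mu>. norm (f x) \<le> B)"
proof (intro iffI conjI)
  assume f: "f \<in> Lp \<mu> \<infinity>"
  then show "f \<in> borel_measurable \<mu>"
    by (simp add: Lp_def)
  define e where "e = esssup \<mu> (\<lambda>x. ennreal (norm (f x)))"
  have "e < \<infinity>"
    using f by (simp add: Lp_def Lp_norm_def e_def)
  moreover have "AE x in \<mu>. ennreal (norm (f x)) \<le> e"
    unfolding e_def by (rule esssup_AE)
  ultimately have "AE x in \<mu>. norm (f x) \<le> enn2real e"
    by (metis (mono_tags, lifting) eventually_mono infinity_ennreal_def ennreal_enn2real
        enn2real_nonneg ennreal_le_iff)
  then show "\<exists>B\<ge>0. AE x in \<mu>. norm (f x) \<le> B"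
    by (intro exI[of _ "enn2real e"]) simp
next
  assume "f \<in> borel_measurable \<mu> \<and> (\<exists>B\<ge>0. AE x in \<mu>. norm (f x) \<le> B)"
  then obtain B where f[measurable]: "f \<in> borel_measurable \<mu>" and B: "AE x in \<mu>. norm (f x) \<le> B"
    by blast
  have "esssup \<mu> (\<lambda>x. ennreal (norm (f x))) \<le> ennreal B"
    using B by (intro esssup_I) (auto intro: ennreal_leI)
  then show "f \<in> Lp \<mu> \<infinity>"
    using order_le_less_trans[OF _ ennreal_less_top] by (auto simp: Lp_def Lp_norm_def)
qed

lemma one_in_Lp_infinity: "(\<lambda>_. 1 :: 'b::real_normed_algebra_1) \<in> Lp \<mu> \<infinity>"
  unfolding Lp_infinity_iff by (auto intro!: exI[of _ 1])

lemma bounded_finite_support_in_L2: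
  fixes f :: "'a \<Rightarrow> 'b::real_normed_vector"
  assumes [measurable]: "f \<in> borel_measurable \<mu>" "A \<in> sets \<mu>"
    and "emeasure \<mu> A < \<infinity>" and bd: "\<And>x. x \<in> A \<Longrightarrow> norm (f x) \<le> B"
    and "\<And>x. x \<notin> A \<Longrightarrow> f x = 0"
  shows "f \<in> Lp \<mu> 2"
proof -
  have "(\<integral>\<^sup>+x. ennreal (norm (f x) powr 2) \<partial>\<mu>) \<le> (\<integral>\<^sup>+x. ennreal (B\<^sup>2) * indicator A x \<partial>\<mu>)"
    using assms(4,5) by (intro nn_integral_mono)
      (auto split: split_indicator intro!: ennreal_leI power_mono)
  also have "\<dots> = ennreal (B\<^sup>2) * emeasure \<mu> A"
    by (simp add: nn_integral_cmult_indicator)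
  also have "\<dots> < \<infinity>"
    using assms(3) by (simp add: ennreal_mult_less_top)
  finally show ?thesis
    by (auto simp: Lp_def Lp_norm_def Let_def)
qed

text \<open>
  A form of Hoelder's inequality that is uniform in the exponent: since \<open>\<bar>f\<bar> \<le> 1 + \<bar>f\<bar>\<^sup>p\<close>,
  a weight which is bounded and integrable pairs with all unit balls at once, and conjugate
  exponents never enter.
\<close>

lemma nn_integral_weight_Lp_le:
  fixes f :: "'a \<Rightarrow> 'b::real_normed_vector"
  assumes p: "1 \<le> p" and f: "f \<in> Lp \<mu> p" "Lp_norm \<mu> p f \<le> 1"
    and w[measurable]: "w \<in> borel_measurable \<mu>"
    and wb: "AE x in \<mu>. w x \<le> b" and wa: "(\<integral>\<^sup>+x. w x \<partial>\<mu>) \<le> a"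
  shows "(\<integral>\<^sup>+x. w x * ennreal (norm (f x)) \<partial>\<mu>) \<le> a + b"
proof -
  have [measurable]: "f \<in> borel_measurable \<mu>"
    using f by (simp add: Lp_def)
  show ?thesis
  proof (cases "p = \<infinity>")
    case True
    have "AE x in \<mu>. ennreal (norm (f x)) \<le> 1"
      using esssup_AE[of "\<lambda>x. ennreal (norm (f x))" \<mu>] f(2) True
      by (auto simp: Lp_norm_def simp del: ennreal_le_1 elim!: eventually_mono intro: order_trans)
    then have "(\<integral>\<^sup>+x. w x * ennreal (norm (f x)) \<partial>\<mu>) \<le> (\<integral>\<^sup>+x. w x \<partial>\<mu>)"
      by (intro nn_integral_mono_AE, eventually_elim)
        (use mult_left_mono[of _ 1] in fastforce)
    also have "\<dots> \<le> a + b"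
      using wa by (rule order_trans) simp
    finally show ?thesis .
  next
    case False
    define r where "r = enn2real p"
    have r: "1 \<le> r"
      using p False unfolding r_def
      by (metis enn2real_1 enn2real_mono infinity_ennreal_def top.not_eq_extremum)
    define I where "I = (\<integral>\<^sup>+x. ennreal (norm (f x) powr r) \<partial>\<mu>)"
    have nI: "I \<noteq> \<infinity>" "ennreal (enn2real I powr (1 / r)) \<le> 1"
      using f(2) False
      by (auto simp: Lp_norm_def Let_def I_def r_def top_unique split: if_splits)
    have "enn2real I \<le> 1"
    proof (rule ccontr)
      assume "\<not> ?thesis"
      then have "1 < enn2real I powr (1 / r)"
        using r by (intro gr_one_powr) auto
      with nI(2) show False
        by (metis ennreal_1 ennreal_le_iff linorder_not_less powr_ge_zero zero_le_one)
    qed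
    then have I1: "I \<le> 1"
      using nI(1) by (metis enn2real_nonneg ennreal_1 ennreal_enn2real ennreal_leI
          infinity_ennreal_def top.not_eq_extremum)
    have key: "y \<le> 1 + y powr r" if "0 \<le> y" for y :: real
    proof (cases "y \<le> 1")
      case False
      then have "y powr 1 \<le> y powr r"
        using r by (intro powr_mono) auto
      with False show ?thesis
        by simp
    qed (simp add: add_increasing2)
    have "(\<integral>\<^sup>+x. w x * ennreal (norm (f x)) \<partial>\<mu>)
        \<le> (\<integral>\<^sup>+x. w x + b * ennreal (norm (f x) powr r) \<partial>\<mu>)"
    proof (rule nn_integral_mono_AE, use wb in eventually_elim)
      fix x assume wx: "w x \<le> b"
      have "w x * ennreal (norm (f x)) \<le> w x * ennreal (1 + norm (f x) powr r)"
        by (intro mult_left_mono ennreal_leI key) auto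
      also have "\<dots> = w x + w x * ennreal (norm (f x) powr r)"
        by (simp add: ennreal_plus distrib_left)
      also have "\<dots> \<le> w x + b * ennreal (norm (f x) powr r)"
        by (intro add_left_mono mult_right_mono wx) auto
      finally show "w x * ennreal (norm (f x)) \<le> w x + b * ennreal (norm (f x) powr r)" .
    qed
    also have "\<dots> = (\<integral>\<^sup>+x. w x \<partial>\<mu>) + b * I"
      by (simp add: nn_integral_add nn_integral_cmult I_def)
    also have "\<dots> \<le> a + b"
      using wa mult_left_mono[OF I1, of b] by (intro add_mono) auto
    finally show ?thesis .
  qed
qed

section \<open>Measures of full support on Polish spaces\<close>

locale full_support_measure =
  fixes \<mu> :: "'a::polish_space measure"
  assumes sets_eq: "sets \<mu> = sets borel"
    and locally_finite: "locally_finite_measure \<mu>"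
    and full_support: "measure_support \<mu> = UNIV"
begin

lemma space_eq [simp]: "space \<mu> = UNIV"
  using sets_eq_imp_space_eq[OF sets_eq] by simp

lemma measurable_cong_borel: "borel_measurable \<mu> = borel_measurable borel"
  by (rule measurable_cong_sets[OF sets_eq refl])

lemma continuous_measurable:
  fixes f :: "'a \<Rightarrow> 'b::topological_space"
  shows "continuous_on UNIV f \<Longrightarrow> f \<in> borel_measurable \<mu>"
  by (simp add: measurable_cong_borel borel_measurable_continuous_onI)

lemma sigma_finite: "sigma_finite_measure \<mu>"
proof
  obtain U where U: "\<And>x::'a. open (U x)" "\<And>x. x \<in> U x" "\<And>x. emeasure \<mu> (U x) < \<infinity>"
    using locally_finite unfolding locally_finite_measure_def by metis
  obtain F where F: "F \<subseteq> range U" "countable F" "\<Union>F = \<Union>(range U)"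
    using Lindelof[of "range U"] U(1) by auto
  show "\<exists>A. countable A \<and> A \<subseteq> sets \<mu> \<and> \<Union> A = space \<mu> \<and> (\<forall>a\<in>A. emeasure \<mu> a \<noteq> \<infinity>)"
  proof (intro exI[of _ F] conjI ballI)
    show "F \<subseteq> sets \<mu>"
      using F(1) U(1) sets_eq by auto
    show "\<Union>F = space \<mu>"
      using F(3) U(2) by auto
    show "emeasure \<mu> a \<noteq> \<infinity>" if "a \<in> F" for a
      using subsetD[OF F(1) that] U(3) by (auto simp: less_top[symmetric])
  qed (rule F(2))
qed

lemma pair_sigma_finite: "pair_sigma_finite \<mu> \<mu>"
  by (simp add: pair_sigma_finite_def sigma_finite)

text \<open>
  Inequalities between continuous functions need only be proved almost everywhere. This gives access
  to measures that are singular to \<open>\<mu>\<close>.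
\<close>

lemma AE_imp_everywhere:
  assumes "closed {x. P x}" and "AE x in \<mu>. P x"
  shows "P x"
proof (rule ccontr)
  assume "\<not> P x"
  have "open {x. \<not> P x}"
    using assms(1) by (simp add: closed_def Compl_eq)
  then have "0 < emeasure \<mu> {x. \<not> P x}"
    using full_support \<open>\<not> P x\<close> by (auto simp: measure_support_def)
  moreover have "emeasure \<mu> {x. \<not> P x} = 0"
    using assms(2) \<open>open {x. \<not> P x}\<close> by (subst (asm) AE_iff_measurable[OF _ refl]) (auto simp: sets_eq)
  ultimately show False
    by simp
qed

lemma cont_version:
  fixes g :: "'a \<Rightarrow> 'b::t2_space"
  assumes "continuous_on UNIV h" and "AE x in \<mu>. h x = g x"
  shows "cont_version \<mu> g = h"
  unfolding cont_version_def
proof (rule the_equality)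
  fix k assume k: "continuous_on UNIV k \<and> (AE x in \<mu>. k x = g x)"
  have "AE x in \<mu>. k x = h x"
    using k assms(2) by (auto elim: eventually_elim2)
  moreover have "closed {x. k x = h x}"
    using k assms(1) by (intro closed_Collect_eq) auto
  ultimately show "k = h"
    using AE_imp_everywhere by blast
qed (use assms in auto)

end

section \<open>Kernels of positivity preserving operators\<close>

text \<open>
  Testing with finite unions of basic open sets compares the positive part \<open>P\<close> and the negative part
  \<open>N\<close> of \<open>k \<mu>\<close> on all open sets, by monotone limits; outer regularity of the finite measure \<open>P\<close> then
  extends \<open>N \<le> P\<close> to the set \<open>{k < 0}\<close>, where \<open>P\<close> vanishes.
\<close>

lemma (in full_support_measure) nonneg_AE_if_integral_open_nonneg:
  fixes k :: "'a \<Rightarrow> real" and \<B> :: "'a set set"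
  assumes k: "integrable \<mu> k"
    and \<B>: "countable \<B>" "topological_basis \<B>"
    and nonneg: "\<And>F. finite F \<Longrightarrow> F \<subseteq> \<B> \<Longrightarrow> 0 \<le> (\<integral>x. indicator (\<Union>F) x * k x \<partial>\<mu>)"
  shows "AE x in \<mu>. 0 \<le> k x"
proof -
  have k_meas[measurable]: "k \<in> borel_measurable \<mu>"
    using k by auto
  define P where "P = density \<mu> (\<lambda>x. ennreal (k x))"
  define N where "N = density \<mu> (\<lambda>x. ennreal (- k x))"
  have sets_PN[simp]: "sets P = sets borel" "sets N = sets borel"
    by (auto simp: P_def N_def sets_eq)
  have opB: "open b" if "b \<in> \<B>" for b
    using \<B>(2) that by (rule topological_basis_open)
  have fin: "(\<integral>\<^sup>+x. ennreal (k x) \<partial>\<mu>) \<noteq> \<infinity>" "(\<integral>\<^sup>+x. ennreal (- k x) \<partial>\<mu>) \<noteq> \<infinity>"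
    using k by (auto simp: real_integrable_def)
  have N_le_P_basic: "emeasure N (\<Union>F) \<le> emeasure P (\<Union>F)" if F: "finite F" "F \<subseteq> \<B>" for F
  proof -
    have O[measurable]: "\<Union>F \<in> sets \<mu>"
      using opB F by (auto simp: sets_eq intro!: borel_open)
    have int: "integrable \<mu> (\<lambda>x. indicator (\<Union>F) x * k x)"
      using integrable_mult_indicator[OF O k] by simp
    have "(\<integral>x. indicator (\<Union>F) x * k x \<partial>\<mu>)
        = enn2real (\<integral>\<^sup>+x. ennreal (indicator (\<Union>F) x * k x) \<partial>\<mu>)
          - enn2real (\<integral>\<^sup>+x. ennreal (- (indicator (\<Union>F) x * k x)) \<partial>\<mu>)"
      using int by (rule real_lebesgue_integral_def)
    moreover have "(\<integral>\<^sup>+x. ennreal (indicator (\<Union>F) x * k x) \<partial>\<mu>) = emeasure P (\<Union>F)"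
      unfolding P_def by (subst emeasure_density)
        (auto intro!: nn_integral_cong split: split_indicator)
    moreover have "(\<integral>\<^sup>+x. ennreal (- (indicator (\<Union>F) x * k x)) \<partial>\<mu>) = emeasure N (\<Union>F)"
      unfolding N_def by (subst emeasure_density)
        (auto intro!: nn_integral_cong split: split_indicator)
    moreover have "emeasure P (\<Union>F) < \<infinity>" "emeasure N (\<Union>F) < \<infinity>"
      using int calculation(2,3) by (auto simp: real_integrable_def top.not_eq_extremum)
    ultimately show ?thesis
      using nonneg[OF F] by (metis diff_ge_0_iff_ge enn2real_nonneg ennreal_enn2real ennreal_leI
          infinity_ennreal_def)
  qed
  have N_le_P_open: "emeasure N S \<le> emeasure P S" if S: "open S" for S
  proof -
    obtain C where C: "C \<subseteq> \<B>" "\<Union>C = S"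
      using \<B>(2) S unfolding topological_basis_def by blast
    have "countable C"
      using C(1) \<B>(1) by (rule countable_subset)
    show ?thesis
    proof (cases "C = {}")
      case False
      define G where "G n = \<Union>(from_nat_into C ` {..n})" for n :: nat
      have G_sub: "from_nat_into C ` {..n} \<subseteq> C" for n
        using False by (auto intro: from_nat_into)
      have G_le: "emeasure N (G n) \<le> emeasure P (G n)" for n
        unfolding G_def using G_sub C(1) by (intro N_le_P_basic) auto
      have G_un: "(\<Union>n. G n) = S"
      proof -
        have "(\<Union>n. G n) = \<Union>(range (from_nat_into C))"
          by (auto simp: G_def)
        then show ?thesis
          using \<open>countable C\<close> False C(2) by (simp add: range_from_nat_into)
      qed
      have inc: "incseq G"
        unfolding G_def by (intro incseq_SucI Union_mono image_mono) auto
      have G_sets: "G n \<in> sets borel" for n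
        unfolding G_def using G_sub C(1) opB by (intro borel_open open_Union) blast
      have "(SUP n. emeasure N (G n)) = emeasure N S" "(SUP n. emeasure P (G n)) = emeasure P S"
        using SUP_emeasure_incseq[of G N] SUP_emeasure_incseq[of G P] inc G_un G_sets by auto
      moreover have "(SUP n. emeasure N (G n)) \<le> (SUP n. emeasure P (G n))"
        using G_le by (intro SUP_mono) auto
      ultimately show ?thesis
        by simp
    qed (simp add: C(2)[symmetric])
  qed
  define E where "E = {x. k x < 0}"
  have E: "E \<in> sets \<mu>"
    using borel_measurable_less[OF k_meas borel_measurable_const[of 0]] by (simp add: E_def)
  have "emeasure N E \<le> emeasure P S" if "S \<in> {S. E \<subseteq> S \<and> open S}" for S
  proof -
    have "emeasure N E \<le> emeasure N S"
      using that by (intro emeasure_mono) auto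
    then show ?thesis
      using N_le_P_open[of S] that by auto
  qed
  moreover have "emeasure P E = (INF S \<in> {S. E \<subseteq> S \<and> open S}. emeasure P S)"
  proof (rule outer_regular)
    show "emeasure P (space P) \<noteq> \<infinity>"
      using fin(1) emeasure_density[of "\<lambda>x. ennreal (k x)" \<mu> UNIV] by (simp add: P_def sets_eq)
  qed (use E sets_eq in auto)
  ultimately have "emeasure N E \<le> emeasure P E"
    by (auto intro!: INF_greatest)
  also have "emeasure P E = 0"
    unfolding P_def using E by (subst emeasure_density)
      (auto simp: E_def ennreal_neg split: split_indicator intro!: nn_integral_zero' AE_I2)
  finally have "(\<integral>\<^sup>+x. ennreal (- k x) * indicator E x \<partial>\<mu>) = 0"
    unfolding N_def using E by (subst (asm) emeasure_density) auto
  then have "AE x in \<mu>. ennreal (- k x) * indicator E x = 0"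
    using E by (subst (asm) nn_integral_0_iff_AE) auto
  then show ?thesis
    by (auto simp: E_def split: split_indicator_asm elim!: eventually_mono)
qed

text \<open>
  An exceptional null set for each test set must be replaced by one for all of them, and only
  countably many test sets can be afforded: finite unions of basic open sets of finite measure.
\<close>

lemma (in full_support_measure) kernel_nonneg_AE:
  fixes k :: "'a \<Rightarrow> 'a \<Rightarrow> real"
  assumes int: "AE x in \<mu>. integrable \<mu> (k x)"
    and pos: "\<And>A. A \<in> sets \<mu> \<Longrightarrow> emeasure \<mu> A < \<infinity> \<Longrightarrow> AE x in \<mu>. 0 \<le> (\<integral>y. indicator A y * k x y \<partial>\<mu>)"
  shows "AE x in \<mu>. AE y in \<mu>. 0 \<le> k x y"
proof -
  obtain \<B>0 :: "'a set set" where \<B>0: "countable \<B>0" "topological_basis \<B>0"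
    using ex_countable_basis by blast
  define \<B> where "\<B> = {b \<in> \<B>0. emeasure \<mu> b < \<infinity>}"
  have opB: "open b" if "b \<in> \<B>" for b
    using topological_basis_open[OF \<B>0(2)] that by (auto simp: \<B>_def)
  have basis: "topological_basis \<B>"
  proof (rule topological_basisI)
    fix S :: "'a set" and x assume S: "open S" "x \<in> S"
    obtain U where U: "open U" "x \<in> U" "emeasure \<mu> U < \<infinity>"
      using locally_finite unfolding locally_finite_measure_def by blast
    obtain b where b: "b \<in> \<B>0" "x \<in> b" "b \<subseteq> S \<inter> U"
      using topological_basisE[OF \<B>0(2), of "S \<inter> U" x] S U by blast
    have "emeasure \<mu> b \<le> emeasure \<mu> U"
      using b U(1) by (intro emeasure_mono) (auto simp: sets_eq)
    then have "b \<in> \<B>"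
      using b(1) U(3) by (auto simp: \<B>_def)
    then show "\<exists>b\<in>\<B>. x \<in> b \<and> b \<subseteq> S"
      using b by blast
  qed (rule opB)
  have countable: "countable \<B>"
    using \<B>0(1) by (auto simp: \<B>_def intro: countable_subset[of _ \<B>0])
  have "AE x in \<mu>. \<forall>F \<in> {F. finite F \<and> F \<subseteq> \<B>}. 0 \<le> (\<integral>y. indicator (\<Union>F) y * k x y \<partial>\<mu>)"
  proof (subst AE_ball_countable[OF countable_Collect_finite_subset[OF countable]], intro ballI pos)
    fix F assume F: "F \<in> {F. finite F \<and> F \<subseteq> \<B>}"
    then show F_sets: "\<Union>F \<in> sets \<mu>"
      using opB by (auto simp: sets_eq intro!: borel_open)
    have "emeasure \<mu> (\<Union>b\<in>F. b) \<le> (\<Sum>b\<in>F. emeasure \<mu> b)"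
      using F opB by (intro emeasure_subadditive_finite) (auto simp: sets_eq)
    also have "\<dots> < \<infinity>"
      using F by (auto simp: \<B>_def less_top[symmetric])
    finally show "emeasure \<mu> (\<Union>F) < \<infinity>"
      by simp
  qed
  with int show ?thesis
    by eventually_elim (rule nonneg_AE_if_integral_open_nonneg[OF _ countable basis], auto)
qed

locale positive_kernel_semigroup = full_support_measure \<mu>
  for \<mu> :: "'a::polish_space measure" +
  fixes u :: "real \<Rightarrow> 'a \<Rightarrow> 'a \<Rightarrow> real"
  assumes kernel_measurable: "\<And>t. t > 0 \<Longrightarrow> (\<lambda>(x, y). u t x y) \<in> borel_measurable (\<mu> \<Otimes>\<^sub>M \<mu>)"
    and kernel_nonneg: "\<And>t. t > 0 \<Longrightarrow> AE x in \<mu>. AE y in \<mu>. 0 \<le> u t x y"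
    and semigroup: "L2_semigroup \<mu> u"
    and Feller: "strong_Feller \<mu> u"
begin

abbreviation mass :: "real \<Rightarrow> 'a \<Rightarrow> real" where
  "mass t x \<equiv> (\<integral>y. u t x y \<partial>\<mu>)"

lemma kernel_measurable':
  "t > 0 \<Longrightarrow> (\<lambda>p. u t (fst p) (snd p)) \<in> borel_measurable (\<mu> \<Otimes>\<^sub>M \<mu>)"
  using kernel_measurable[of t] by (simp add: split_beta')

lemma kernel_row_measurable: "t > 0 \<Longrightarrow> u t x \<in> borel_measurable \<mu>"
  using measurable_Pair2[OF kernel_measurable, of t x] by simp

lemma kernel_op_measurable:
  fixes f :: "'a \<Rightarrow> 'b::{banach, second_countable_topology}"
  assumes t: "t > 0" and [measurable]: "f \<in> borel_measurable \<mu>"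
  shows "kernel_op \<mu> (u t) f \<in> borel_measurable \<mu>"
proof -
  interpret sigma_finite_measure \<mu> by (rule sigma_finite)
  note kernel_measurable'[OF t, measurable]
  show ?thesis
    unfolding kernel_op_def
    by (rule borel_measurable_lebesgue_integral) (simp add: split_beta')
qed

lemma kernel_row_integrable:
  assumes t: "t > 0"
  shows "AE x in \<mu>. integrable \<mu> (u t x)"
proof -
  have "AE x in \<mu>. integrable \<mu> (\<lambda>y. u t x y *\<^sub>R (1::complex))"
    using Feller[unfolded strong_Feller_def, rule_format, OF t one_in_Lp_infinity]
    unfolding kernel_op_exists_def by (rule conjunct1)
  then show ?thesis
  proof eventually_elim
    case (elim x)
    then have "integrable \<mu> (\<lambda>y. Re (u t x y *\<^sub>R (1::complex)))"
      by (rule integrable_Re)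
    then show ?case
      by simp
  qed
qed

lemma continuous_version_complex:
  fixes f :: "'a \<Rightarrow> complex"
  assumes t: "t > 0" and f: "f \<in> Lp \<mu> \<infinity>"
  obtains h where "continuous_on UNIV h" "bounded (range h)" "AE x in \<mu>. h x = kernel_op \<mu> (u t) f x"
proof -
  have "\<exists>h. continuous_on UNIV h \<and> bounded (range h) \<and> (AE x in \<mu>. h x = sg \<mu> u t f x)"
    using Feller[unfolded strong_Feller_def, rule_format, OF t f] by (rule conjunct2)
  then show ?thesis
    using that t unfolding sg_def by auto
qed

text \<open>
  The strong Feller property speaks of complex functions; the real constant \<open>1\<close> inherits it by
  taking real parts.
\<close>

lemma continuous_mass:
  assumes t: "t > 0"
  shows "continuous_on UNIV (sg_cont \<mu> u t (\<lambda>_. 1 :: real))"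
    and "bounded (range (sg_cont \<mu> u t (\<lambda>_. 1 :: real)))"
    and "AE x in \<mu>. sg_cont \<mu> u t (\<lambda>_. 1 :: real) x = mass t x"
proof -
  obtain h :: "'a \<Rightarrow> complex" where h: "continuous_on UNIV h" "bounded (range h)"
    "AE x in \<mu>. h x = kernel_op \<mu> (u t) (\<lambda>_. 1) x"
    using continuous_version_complex[OF t one_in_Lp_infinity] by blast
  have eq: "AE x in \<mu>. Re (h x) = mass t x"
    using h(3) kernel_row_integrable[OF t]
  proof eventually_elim
    case (elim x)
    have "integrable \<mu> (\<lambda>y. complex_of_real (u t x y))"
      using elim(2) by (simp add: complex_of_real_integrable_eq)
    then show ?case
      using elim(1) by (simp add: kernel_op_def scaleR_conv_of_real)
  qed
  have *: "sg_cont \<mu> u t (\<lambda>_. 1) = (\<lambda>x. Re (h x))"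
    unfolding sg_cont_def using eq h(1) t
    by (intro cont_version) (auto simp: sg_def kernel_op_def intro!: continuous_intros)
  show "continuous_on UNIV (sg_cont \<mu> u t (\<lambda>_. 1 :: real))"
    unfolding * by (intro continuous_intros h)
  show "bounded (range (sg_cont \<mu> u t (\<lambda>_. 1 :: real)))"
  proof -
    obtain B where "\<And>x. norm (h x) \<le> B"
      using h(2) by (auto simp: bounded_iff)
    then show ?thesis
      unfolding * bounded_iff using order_trans[OF abs_Re_le_cmod] by auto
  qed
  show "AE x in \<mu>. sg_cont \<mu> u t (\<lambda>_. 1 :: real) x = mass t x"
    unfolding * by (rule eq)
qed

lemma mass_bounded:
  assumes t: "t > 0"
  obtains c where "0 \<le> c" "AE x in \<mu>. mass t x \<le> c"
proof -
  obtain B where B: "\<And>x. norm (sg_cont \<mu> u t (\<lambda>_. 1 :: real) x) \<le> B"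
    using continuous_mass(2)[OF t] by (auto simp: bounded_iff)
  have "AE x in \<mu>. mass t x \<le> max 0 B"
    using continuous_mass(3)[OF t] by eventually_elim (metis B abs_le_D1 max.coboundedI2 real_norm_def)
  then show ?thesis
    using that[of "max 0 B"] by simp
qed

lemma kernel_op_bounded:
  fixes f :: "'a \<Rightarrow> 'b::{banach, second_countable_topology}"
  assumes t: "t > 0" and f[measurable]: "f \<in> borel_measurable \<mu>" and B: "AE y in \<mu>. norm (f y) \<le> B"
  shows "AE x in \<mu>. integrable \<mu> (\<lambda>y. u t x y *\<^sub>R f y) \<and> norm (kernel_op \<mu> (u t) f x) \<le> B * mass t x"
  using kernel_row_integrable[OF t] kernel_nonneg[OF t]
proof eventually_elim
  case (elim x)
  note [measurable] = kernel_row_measurable[OF t, of x]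
  have bd: "AE y in \<mu>. norm (u t x y *\<^sub>R f y) \<le> B * u t x y"
    using elim(2) B by eventually_elim (simp add: mult.commute mult_right_mono)
  have int: "integrable \<mu> (\<lambda>y. B * u t x y)"
    using elim(1) by simp
  have 1: "integrable \<mu> (\<lambda>y. u t x y *\<^sub>R f y)"
    by (rule Bochner_Integration.integrable_bound[OF int])
      (use bd in \<open>auto elim!: eventually_mono\<close>)
  moreover have "norm (kernel_op \<mu> (u t) f x) \<le> (\<integral>y. norm (u t x y *\<^sub>R f y) \<partial>\<mu>)"
    unfolding kernel_op_def by (rule integral_norm_bound)
  moreover have "\<dots> \<le> (\<integral>y. B * u t x y \<partial>\<mu>)"
    using 1 int bd by (intro integral_mono_AE integrable_norm)
  ultimately show ?case
    by simp
qed

text \<open>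
  The semigroup law is given on $L^2$ only. For other functions it follows by truncation: the
  integrability hypotheses provide the dominating functions for both sides.
\<close>

lemma kernel_op_add:
  fixes f :: "'a \<Rightarrow> complex"
  assumes s: "s > 0" and t: "t > 0" and f[measurable]: "f \<in> borel_measurable \<mu>"
    and A: "AE x in \<mu>. integrable \<mu> (\<lambda>y. u (s + t) x y *\<^sub>R f y)"
    and B: "AE z in \<mu>. integrable \<mu> (\<lambda>y. u t z y *\<^sub>R f y)"
    and C: "AE x in \<mu>. integrable \<mu> (\<lambda>z. u s x z * (\<integral>y. norm (u t z y *\<^sub>R f y) \<partial>\<mu>))"
  shows "AE x in \<mu>. kernel_op \<mu> (u (s + t)) f x = kernel_op \<mu> (u s) (kernel_op \<mu> (u t) f) x"
proof -
  interpret sigma_finite_measure \<mu> by (rule sigma_finite)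
  have st: "s + t > 0"
    using s t by simp
  obtain K where K: "range K \<subseteq> sets \<mu>" "(\<Union>i. K i) = space \<mu>" "\<And>i. emeasure \<mu> (K i) \<noteq> \<infinity>" "incseq K"
    using sigma_finite_incseq by blast
  define S where "S n = K n \<inter> {x. norm (f x) \<le> real n}" for n :: nat
  have S[measurable]: "S n \<in> sets \<mu>" for n
  proof -
    have "{x \<in> space \<mu>. norm (f x) \<le> real n} \<in> sets \<mu>"
      by measurable
    then show ?thesis
      using K(1) unfolding S_def by auto
  qed
  define F where "F n x = indicator (S n) x *\<^sub>R f x" for n x
  have F[measurable]: "F n \<in> borel_measurable \<mu>" for n
    unfolding F_def by measurable
  have F_le: "norm (F n x) \<le> norm (f x)" for n x
    by (auto simp: F_def split: split_indicator)
  have F_L2: "F n \<in> Lp \<mu> 2" for n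
  proof (rule bounded_finite_support_in_L2[OF F S])
    have "emeasure \<mu> (S n) \<le> emeasure \<mu> (K n)"
      using K(1) by (intro emeasure_mono) (auto simp: S_def)
    then show "emeasure \<mu> (S n) < \<infinity>"
      using K(3)[of n] by (simp add: less_top order_le_less_trans)
  qed (auto simp: F_def S_def)
  have F_lim: "(\<lambda>n. F n x) \<longlonglongrightarrow> f x" for x
  proof (rule tendsto_eventually)
    obtain i where i: "x \<in> K i"
      using K(2) by auto
    obtain j :: nat where j: "norm (f x) \<le> real j"
      using real_arch_simple by blast
    have "x \<in> S n" if "n \<ge> max i j" for n
      using that i j incseqD[OF K(4), of i n] by (auto simp: S_def)
    then show "\<forall>\<^sub>F n in sequentially. F n x = f x"
      by (auto simp: F_def eventually_sequentially intro!: exI[of _ "max i j"])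
  qed
  have eq: "AE x in \<mu>. \<forall>n. kernel_op \<mu> (u (s + t)) (F n) x = kernel_op \<mu> (u s) (kernel_op \<mu> (u t) (F n)) x"
    unfolding AE_all_countable
    using semigroup F_L2 s t by (auto simp: L2_semigroup_def sg_def)
  have lim: "(\<lambda>n. kernel_op \<mu> (u r) (F n) x) \<longlonglongrightarrow> kernel_op \<mu> (u r) f x"
    and bound: "norm (kernel_op \<mu> (u r) (F n) x) \<le> (\<integral>y. norm (u r x y *\<^sub>R f y) \<partial>\<mu>)"
    if r: "r > 0" and int: "integrable \<mu> (\<lambda>y. u r x y *\<^sub>R f y)" for r x n
  proof -
    note [measurable] = kernel_row_measurable[OF r, of x]
    have le: "norm (u r x y *\<^sub>R F n y) \<le> norm (u r x y *\<^sub>R f y)" for n y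
      using F_le by (simp add: mult_left_mono)
    show "(\<lambda>n. kernel_op \<mu> (u r) (F n) x) \<longlonglongrightarrow> kernel_op \<mu> (u r) f x"
      unfolding kernel_op_def
      by (rule integral_dominated_convergence[where w = "\<lambda>y. norm (u r x y *\<^sub>R f y)"])
        (use integrable_norm[OF int] F_lim le in \<open>auto intro!: tendsto_intros\<close>)
    have "norm (kernel_op \<mu> (u r) (F n) x) \<le> (\<integral>y. norm (u r x y *\<^sub>R F n y) \<partial>\<mu>)"
      unfolding kernel_op_def by (rule integral_norm_bound)
    also have "\<dots> \<le> (\<integral>y. norm (u r x y *\<^sub>R f y) \<partial>\<mu>)"
    proof (rule integral_mono)
      show "integrable \<mu> (\<lambda>y. norm (u r x y *\<^sub>R F n y))"
        by (rule Bochner_Integration.integrable_bound[OF integrable_norm[OF int]]) (use le in auto)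
    qed (use integrable_norm[OF int] le in auto)
    finally show "norm (kernel_op \<mu> (u r) (F n) x) \<le> (\<integral>y. norm (u r x y *\<^sub>R f y) \<partial>\<mu>)" .
  qed
  from eq A C show ?thesis
  proof eventually_elim
    case (elim x)
    note [measurable] = kernel_row_measurable[OF s, of x] kernel_op_measurable[OF t]
    have "(\<lambda>n. kernel_op \<mu> (u s) (kernel_op \<mu> (u t) (F n)) x) \<longlonglongrightarrow> kernel_op \<mu> (u s) (kernel_op \<mu> (u t) f) x"
      unfolding kernel_op_def[of \<mu> "u s"]
    proof (rule integral_dominated_convergence[where
          w = "\<lambda>z. norm (u s x z * (\<integral>y. norm (u t z y *\<^sub>R f y) \<partial>\<mu>))"])
      show "integrable \<mu> (\<lambda>z. norm (u s x z * (\<integral>y. norm (u t z y *\<^sub>R f y) \<partial>\<mu>)))"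
        using elim(3) by (rule integrable_norm)
      show "AE z in \<mu>. (\<lambda>n. u s x z *\<^sub>R kernel_op \<mu> (u t) (F n) z) \<longlonglongrightarrow> u s x z *\<^sub>R kernel_op \<mu> (u t) f z"
        using B by eventually_elim (intro tendsto_intros lim t)
      show "AE z in \<mu>. norm (u s x z *\<^sub>R kernel_op \<mu> (u t) (F n) z)
          \<le> norm (u s x z * (\<integral>y. norm (u t z y *\<^sub>R f y) \<partial>\<mu>))" for n
        using B
      proof eventually_elim
        case (elim z)
        have "norm (kernel_op \<mu> (u t) (F n) z) \<le> (\<integral>y. norm (u t z y *\<^sub>R f y) \<partial>\<mu>)"
          using bound[OF t elim] .
        then show ?case
          by (simp add: abs_mult mult_left_mono del: norm_scaleR) (simp add: mult_left_mono)
      qed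
    qed (measurable)
    moreover have "(\<lambda>n. kernel_op \<mu> (u s) (kernel_op \<mu> (u t) (F n)) x) \<longlonglongrightarrow> kernel_op \<mu> (u (s + t)) f x"
      using lim[OF st elim(2)] elim(1) by simp
    ultimately show ?case
      using LIMSEQ_unique by blast
  qed
qed

lemma heat_content_eq:
  assumes t: "t > 0"
  shows "heat_content \<mu> u t = (\<integral>\<^sup>+x. \<integral>\<^sup>+y. ennreal (u t x y) \<partial>\<mu> \<partial>\<mu>)"
  unfolding heat_content_def
proof (rule nn_integral_cong_AE, use kernel_row_integrable[OF t] kernel_nonneg[OF t] in eventually_elim)
  case (elim x)
  then show ?case
    using t by (simp add: sg_def kernel_op_def nn_integral_eq_integral)
qed

end

text \<open>
  Fubini's theorem for \<open>w(x) u\<^sub>t(x, y) f(y)\<close>, where integrability is known in the order that integrates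
  over \<open>x\<close> first. The weight \<open>w = 1\<close> yields $L^1$ bounds, and the ground state as weight yields an
  invariant functional.
\<close>

lemma (in positive_kernel_semigroup) kernel_op_duality:
  fixes f :: "'a \<Rightarrow> 'b::{banach, second_countable_topology}" and w :: "'a \<Rightarrow> real"
  assumes t: "t > 0" and f[measurable]: "f \<in> borel_measurable \<mu>"
    and w[measurable]: "w \<in> borel_measurable \<mu>" and w_pos: "AE x in \<mu>. 0 < w x" 
    and w_int: "AE y in \<mu>. integrable \<mu> (\<lambda>x. u t x y * w x)"
    and int: "integrable \<mu> (\<lambda>y. (\<integral>x. u t x y * w x \<partial>\<mu>) *\<^sub>R f y)"
  shows "AE x in \<mu>. integrable \<mu> (\<lambda>y. u t x y *\<^sub>R f y)"
    and "integrable \<mu> (\<lambda>x. w x *\<^sub>R kernel_op \<mu> (u t) f x)"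
    and "(\<integral>x. w x *\<^sub>R kernel_op \<mu> (u t) f x \<partial>\<mu>) = (\<integral>y. (\<integral>x. u t x y * w x \<partial>\<mu>) *\<^sub>R f y \<partial>\<mu>)"
proof -
  interpret pair_sigma_finite \<mu> \<mu> by (rule pair_sigma_finite)
  note kernel_measurable'[OF t, measurable]
  define h where "h p = (w (fst p) * u t (fst p) (snd p)) *\<^sub>R f (snd p)" for p
  have h[measurable]: "h \<in> borel_measurable (\<mu> \<Otimes>\<^sub>M \<mu>)"
    unfolding h_def by measurable
  have nonneg: "AE y in \<mu>. AE x in \<mu>. 0 \<le> u t x y"
    using kernel_nonneg[OF t] by (subst (asm) AE_commute) auto
  have "(\<integral>\<^sup>+p. norm (h p) \<partial>(\<mu> \<Otimes>\<^sub>M \<mu>)) = (\<integral>\<^sup>+y. \<integral>\<^sup>+x. norm (h (x, y)) \<partial>\<mu> \<partial>\<mu>)"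
    using nn_integral_snd[of "\<lambda>p. ennreal (norm (h p))"] by simp
  also have "\<dots> = (\<integral>\<^sup>+y. norm ((\<integral>x. u t x y * w x \<partial>\<mu>) *\<^sub>R f y) \<partial>\<mu>)"
  proof (rule nn_integral_cong_AE, use w_int nonneg in eventually_elim)
    case (elim y)
    have ae: "AE x in \<mu>. 0 \<le> u t x y * w x"
      using elim(2) w_pos by eventually_elim simp
    have "(\<integral>\<^sup>+x. norm (h (x, y)) \<partial>\<mu>) = (\<integral>\<^sup>+x. ennreal (u t x y * w x) * ennreal (norm (f y)) \<partial>\<mu>)"
      by (rule nn_integral_cong_AE, use ae in eventually_elim)
        (simp add: h_def mult.commute flip: ennreal_mult)
    also have "\<dots> = (\<integral>\<^sup>+x. ennreal (u t x y * w x) \<partial>\<mu>) * ennreal (norm (f y))"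
      using elim(1) by (intro nn_integral_multc) auto
    also have "\<dots> = ennreal (\<integral>x. u t x y * w x \<partial>\<mu>) * ennreal (norm (f y))"
      using elim(1) ae by (simp add: nn_integral_eq_integral)
    also have "\<dots> = norm ((\<integral>x. u t x y * w x \<partial>\<mu>) *\<^sub>R f y)"
      using integral_nonneg_AE[OF ae] by (simp add: ennreal_mult)
    finally show ?case .
  qed
  also have "\<dots> < \<infinity>"
    using int by (simp add: integrable_iff_bounded)
  finally have h_int: "integrable (\<mu> \<Otimes>\<^sub>M \<mu>) h"
    by (intro integrableI_bounded) auto
  have h_eq: "(\<integral>y. h (x, y) \<partial>\<mu>) = w x *\<^sub>R kernel_op \<mu> (u t) f x" for x
    unfolding h_def kernel_op_def by (simp flip: scaleR_scaleR)
  show "AE x in \<mu>. integrable \<mu> (\<lambda>y. u t x y *\<^sub>R f y)"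
    using AE_integrable_fst'[OF h_int] w_pos
  proof eventually_elim
    case (elim x)
    then have "integrable \<mu> (\<lambda>y. (1 / w x) *\<^sub>R h (x, y))"
      by (intro integrable_scaleR_right)
    then show ?case
      using elim(2) by (simp add: h_def)
  qed
  show "integrable \<mu> (\<lambda>x. w x *\<^sub>R kernel_op \<mu> (u t) f x)"
    using integrable_fst'[OF h_int] by (simp add: h_eq)
  have "(\<integral>x. w x *\<^sub>R kernel_op \<mu> (u t) f x \<partial>\<mu>) = (\<integral>y. \<integral>x. h (x, y) \<partial>\<mu> \<partial>\<mu>)"
    using Fubini_integral[of "\<lambda>x y. h (x, y)"] h_int by (simp add: h_eq)
  also have "\<dots> = (\<integral>y. (\<integral>x. u t x y * w x \<partial>\<mu>) *\<^sub>R f y \<partial>\<mu>)"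
  proof (rule integral_cong_AE)
    show "AE y in \<mu>. (\<integral>x. h (x, y) \<partial>\<mu>) = (\<integral>x. u t x y * w x \<partial>\<mu>) *\<^sub>R f y"
      using w_int by eventually_elim (simp add: h_def mult.commute)
  qed (use int h_int in auto)
  finally show "(\<integral>x. w x *\<^sub>R kernel_op \<mu> (u t) f x \<partial>\<mu>) = (\<integral>y. (\<integral>x. u t x y * w x \<partial>\<mu>) *\<^sub>R f y \<partial>\<mu>)" .
qed

section \<open>Ground states\<close>

text \<open>
  The hypotheses are symmetric under exchanging \<open>u\<close> with its transpose and \<open>\<phi>\<close> with \<open>\<psi>\<close>, so every
  fact below has a dual, obtained by instantiation.
\<close>

locale ground_state_kernel = positive_kernel_semigroup \<mu> u
  for \<mu> :: "'a::polish_space measure" and u +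
  fixes t\<^sub>0 lam \<gamma> :: real and \<phi> \<psi> :: "'a \<Rightarrow> real"
  assumes dual_kernel: "positive_kernel_semigroup \<mu> (transposed u)"
    and t0_pos: "t\<^sub>0 > 0"
    and \<gamma>_pos: "\<gamma> > 0"
    and \<phi>_cont: "continuous_on UNIV \<phi>" and \<phi>_bounded: "bounded (range \<phi>)"
    and \<phi>_pos: "AE x in \<mu>. 0 < \<phi> x" and \<phi>_L2: "\<phi> \<in> Lp \<mu> 2"
    and \<psi>_cont: "continuous_on UNIV \<psi>" and \<psi>_bounded: "bounded (range \<psi>)"
    and \<psi>_pos: "AE x in \<mu>. 0 < \<psi> x" and \<psi>_L2: "\<psi> \<in> Lp \<mu> 2"
    and rate: "kernel_convergence_rate \<mu> u t\<^sub>0 lam \<phi> \<psi> \<gamma>"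
begin

lemma transposed_transposed: "transposed (transposed w) = w"
  by (simp add: transposed_def)

lemma dual: "ground_state_kernel \<mu> (transposed u) t\<^sub>0 lam \<gamma> \<psi> \<phi>"
proof -
  interpret D: positive_kernel_semigroup \<mu> "transposed u" by (rule dual_kernel)
  interpret pair_sigma_finite \<mu> \<mu> by (rule pair_sigma_finite)
  have swap: "AE (x, y) in \<mu> \<Otimes>\<^sub>M \<mu>. P y x" if "AE (x, y) in \<mu> \<Otimes>\<^sub>M \<mu>. P x y" for P
  proof -
    have "AE (x, y) in distr (\<mu> \<Otimes>\<^sub>M \<mu>) (\<mu> \<Otimes>\<^sub>M \<mu>) (\<lambda>(x, y). (y, x)). P x y"
      using that by (subst distr_pair_swap[symmetric])
    then show ?thesis
      using AE_distrD[OF measurable_pair_swap'] by (fastforce simp: split_beta')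
  qed
  have "kernel_convergence_rate \<mu> (transposed u) t\<^sub>0 lam \<psi> \<phi> \<gamma>"
  proof -
    obtain C where C: "C > 0" "\<And>t. t > 2 * t\<^sub>0 \<Longrightarrow> AE (x, y) in \<mu> \<Otimes>\<^sub>M \<mu>.
       \<bar>exp (lam * t) * u t x y - \<phi> x * \<psi> y / (\<integral>z. \<phi> z * \<psi> z \<partial>\<mu>)\<bar> \<le> C * exp (- \<gamma> * t)"
      using rate unfolding kernel_convergence_rate_def by blast
    show ?thesis
      unfolding kernel_convergence_rate_def transposed_def
      using C(1) swap[OF C(2)] by (intro exI[of _ C]) (simp add: mult.commute)
  qed
  then show ?thesis
    by unfold_locales (simp_all add: transposed_transposed kernel_measurable kernel_nonneg semigroup Feller
        t0_pos \<gamma>_pos \<phi>_cont \<phi>_bounded \<phi>_pos \<phi>_L2 \<psi>_cont \<psi>_bounded \<psi>_pos \<psi>_L2)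
qed

lemma \<phi>_measurable[measurable]: "\<phi> \<in> borel_measurable \<mu>"
  and \<psi>_measurable[measurable]: "\<psi> \<in> borel_measurable \<mu>"
  using \<phi>_cont \<psi>_cont by (auto intro: continuous_measurable)

lemma \<phi>_nonneg: "0 \<le> \<phi> x"
  by (rule AE_imp_everywhere[of "\<lambda>x. 0 \<le> \<phi> x"])
    (use \<phi>_cont \<phi>_pos in \<open>auto intro!: closed_Collect_le elim!: eventually_mono\<close>)

lemma \<phi>_bound: obtains b where "b > 0" "\<And>x. \<phi> x \<le> b"
proof -
  obtain b where "\<And>x. \<bar>\<phi> x\<bar> \<le> b"
    using \<phi>_bounded by (auto simp: bounded_iff)
  then have "\<phi> x \<le> max 1 b" for x
    by (metis abs_le_D1 max.coboundedI2)
  then show ?thesis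
    using that[of "max 1 b"] by simp
qed

lemma \<psi>_nonneg: "0 \<le> \<psi> x"
  using ground_state_kernel.\<phi>_nonneg[OF dual] .

lemma \<psi>_bound: obtains b where "b > 0" "\<And>x. \<psi> x \<le> b"
  using ground_state_kernel.\<phi>_bound[OF dual] by blast

lemma square_integrable_L2:
  fixes f :: "'a \<Rightarrow> real"
  assumes "f \<in> Lp \<mu> 2"
  shows "integrable \<mu> (\<lambda>x. (f x)\<^sup>2)"
proof (rule integrableI_bounded)
  have [measurable]: "f \<in> borel_measurable \<mu>"
    using assms by (simp add: Lp_def)
  show "(\<lambda>x. (f x)\<^sup>2) \<in> borel_measurable \<mu>"
    by measurable
  have "(\<integral>\<^sup>+x. ennreal (norm (f x) powr 2) \<partial>\<mu>) < \<infinity>"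
    using assms by (auto simp: Lp_def Lp_norm_def Let_def less_top split: if_splits)
  then show "(\<integral>\<^sup>+x. ennreal (norm ((f x)\<^sup>2)) \<partial>\<mu>) < \<infinity>"
    by simp
qed

text \<open>The constant \<open>\<Lambda>\<close> that normalizes the limit kernel \<open>\<phi>(x) \<psi>(y) / \<Lambda>\<close> to a projection.\<close>

definition overlap :: real where
  "overlap = (\<integral>z. \<phi> z * \<psi> z \<partial>\<mu>)"

lemma space_not_null: "emeasure \<mu> UNIV \<noteq> 0"
proof -
  have "undefined \<in> measure_support \<mu>"
    by (simp add: full_support)
  then show ?thesis
    unfolding measure_support_def using open_UNIV by fastforce
qed

lemma integral_pos_AE:
  fixes f :: "'a \<Rightarrow> real"
  assumes "integrable \<mu> f" and "AE x in \<mu>. 0 < f x"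
  shows "0 < (\<integral>x. f x \<partial>\<mu>)"
proof -
  have "(\<integral>x. f x \<partial>\<mu>) \<noteq> 0"
  proof
    assume "(\<integral>x. f x \<partial>\<mu>) = 0"
    then have "AE x in \<mu>. f x = 0"
      using assms by (subst (asm) integral_nonneg_eq_0_iff_AE) (auto elim: eventually_mono)
    then have "AE x in \<mu>. False"
      using assms(2) by eventually_elim simp
    then show False
      using space_not_null ae_filter_eq_bot_iff[of \<mu>] by (simp add: trivial_limit_def)
  qed
  moreover have "0 \<le> (\<integral>x. f x \<partial>\<mu>)"
    using assms(2) by (intro integral_nonneg_AE) (auto elim: eventually_mono)
  ultimately show ?thesis
    by simp
qed

lemma overlap_pos: "0 < overlap"
  unfolding overlap_def
proof (rule integral_pos_AE)
  have le: "\<bar>\<phi> x * \<psi> x\<bar> \<le> (\<phi> x)\<^sup>2 + (\<psi> x)\<^sup>2" for x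
    using sum_squares_bound[of "\<phi> x" "\<psi> x"] mult_nonneg_nonneg[OF \<phi>_nonneg \<psi>_nonneg, of x x]
    by linarith
  have int: "integrable \<mu> (\<lambda>x. (\<phi> x)\<^sup>2 + (\<psi> x)\<^sup>2)"
    using \<phi>_L2 \<psi>_L2 by (intro Bochner_Integration.integrable_add square_integrable_L2)
  show "integrable \<mu> (\<lambda>x. \<phi> x * \<psi> x)"
    by (rule Bochner_Integration.integrable_bound[OF int]) (use le in auto)
  show "AE x in \<mu>. 0 < \<phi> x * \<psi> x"
    using \<phi>_pos \<psi>_pos by eventually_elim simp
qed

lemma rateE:
  obtains C where "C > 0"
    "\<And>t. t > 2 * t\<^sub>0 \<Longrightarrow> AE x in \<mu>. AE y in \<mu>.
      \<bar>exp (lam * t) * u t x y - \<phi> x * \<psi> y / overlap\<bar> \<le> C * exp (- \<gamma> * t)"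
proof -
  interpret pair_sigma_finite \<mu> \<mu> by (rule pair_sigma_finite)
  obtain C where C: "C > 0" "\<And>t. t > 2 * t\<^sub>0 \<Longrightarrow> AE (x, y) in \<mu> \<Otimes>\<^sub>M \<mu>.
     \<bar>exp (lam * t) * u t x y - \<phi> x * \<psi> y / (\<integral>z. \<phi> z * \<psi> z \<partial>\<mu>)\<bar> \<le> C * exp (- \<gamma> * t)"
    using rate unfolding kernel_convergence_rate_def by blast
  show ?thesis
    using C(1) AE_pair[OF C(2)] by (intro that[of C]) (simp_all add: overlap_def)
qed

text \<open>
  The ground states are bounded, hence so is the kernel at late times.
\<close>

lemma kernel_row_bound:
  assumes t: "t > 2 * t\<^sub>0"
  obtains D where "D \<ge> 0" "AE x in \<mu>. AE y in \<mu>. \<bar>u t x y\<bar> \<le> D"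
proof -
  obtain C where C: "C > 0"
    "\<And>t. t > 2 * t\<^sub>0 \<Longrightarrow> AE x in \<mu>. AE y in \<mu>.
      \<bar>exp (lam * t) * u t x y - \<phi> x * \<psi> y / overlap\<bar> \<le> C * exp (- \<gamma> * t)"
    using rateE by blast
  obtain b where b: "b > 0" "\<And>x. \<phi> x \<le> b" using \<phi>_bound by blast
  obtain b' where b': "b' > 0" "\<And>x. \<psi> x \<le> b'" using \<psi>_bound by blast
  define D where "D = (b * b' / overlap + C * exp (- \<gamma> * t)) / exp (lam * t)"
  have "\<bar>u t x y\<bar> \<le> D"
    if "\<bar>exp (lam * t) * u t x y - \<phi> x * \<psi> y / overlap\<bar> \<le> C * exp (- \<gamma> * t)" for x y
  proof -
    have 1: "0 \<le> \<phi> x * \<psi> y / overlap" "\<phi> x * \<psi> y / overlap \<le> b * b' / overlap"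
      using overlap_pos \<phi>_nonneg[of x] \<psi>_nonneg[of y] b(2)[of x] b'(2)[of y]
      by (auto intro!: divide_right_mono mult_mono)
    have "exp (lam * t) * \<bar>u t x y\<bar> = \<bar>exp (lam * t) * u t x y\<bar>"
      by (simp add: abs_mult)
    also have "\<dots> \<le> b * b' / overlap + C * exp (- \<gamma> * t)"
      using that 1 by linarith
    finally show ?thesis
      by (simp add: D_def pos_le_divide_eq mult.commute)
  qed
  then have "AE x in \<mu>. AE y in \<mu>. \<bar>u t x y\<bar> \<le> D"
    using C(2)[OF t] by (auto elim!: eventually_mono)
  moreover have "0 \<le> D"
    using b b' C(1) overlap_pos by (simp add: D_def)
  ultimately show ?thesis
    by (rule that[rotated])
qed

text \<open>
  On $L^1$ the kernel estimate becomes a convergence of operators in the supremum norm.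
\<close>

lemma L1_Linfty_rate:
  obtains C where "C > 0"
    "\<And>t g. t > 2 * t\<^sub>0 \<Longrightarrow> integrable \<mu> (g :: 'a \<Rightarrow> 'b::{banach, second_countable_topology}) \<Longrightarrow>
      AE x in \<mu>. integrable \<mu> (\<lambda>y. u t x y *\<^sub>R g y) \<and>
        norm (exp (lam * t) *\<^sub>R kernel_op \<mu> (u t) g x - (\<phi> x / overlap) *\<^sub>R (\<integral>y. \<psi> y *\<^sub>R g y \<partial>\<mu>))
          \<le> C * exp (- \<gamma> * t) * (\<integral>y. norm (g y) \<partial>\<mu>)"
proof -
  obtain C where C: "C > 0"
    "\<And>t. t > 2 * t\<^sub>0 \<Longrightarrow> AE x in \<mu>. AE y in \<mu>.
      \<bar>exp (lam * t) * u t x y - \<phi> x * \<psi> y / overlap\<bar> \<le> C * exp (- \<gamma> * t)"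
    using rateE by blast
  have "AE x in \<mu>. integrable \<mu> (\<lambda>y. u t x y *\<^sub>R g y) \<and>
        norm (exp (lam * t) *\<^sub>R kernel_op \<mu> (u t) g x - (\<phi> x / overlap) *\<^sub>R (\<integral>y. \<psi> y *\<^sub>R g y \<partial>\<mu>))
          \<le> C * exp (- \<gamma> * t) * (\<integral>y. norm (g y) \<partial>\<mu>)"
    if t: "t > 2 * t\<^sub>0" and g: "integrable \<mu> g" for t and g :: "'a \<Rightarrow> 'b"
  proof -
    have t': "t > 0"
      using t t0_pos by simp
    obtain D where D: "D \<ge> 0" "AE x in \<mu>. AE y in \<mu>. \<bar>u t x y\<bar> \<le> D"
      using kernel_row_bound[OF t] by blast
    obtain b where b: "b > 0" "\<And>x. \<psi> x \<le> b" using \<psi>_bound by blast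
    have [measurable]: "g \<in> borel_measurable \<mu>"
      using g by auto
    have \<psi>g: "integrable \<mu> (\<lambda>y. \<psi> y *\<^sub>R g y)"
      by (rule Bochner_Integration.integrable_bound[OF integrable_mult_right[OF integrable_norm[OF g], of b]])
        (use b \<psi>_nonneg in \<open>auto intro!: mult_right_mono\<close>)
    from C(2)[OF t] D(2) show ?thesis
    proof eventually_elim
      case (elim x)
      note [measurable] = kernel_row_measurable[OF t', of x]
      let ?d = "\<lambda>y. exp (lam * t) * u t x y - \<phi> x * \<psi> y / overlap"
      have int: "integrable \<mu> (\<lambda>y. u t x y *\<^sub>R g y)"
        by (rule Bochner_Integration.integrable_bound[OF integrable_mult_right[OF integrable_norm[OF g], of D]])
          (use elim(2) D(1) in \<open>auto intro!: mult_right_mono elim!: eventually_mono\<close>)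
      have eq: "?d y *\<^sub>R g y = exp (lam * t) *\<^sub>R (u t x y *\<^sub>R g y) - (\<phi> x / overlap) *\<^sub>R (\<psi> y *\<^sub>R g y)" for y
        by (simp add: scaleR_diff_left)
      have d_int: "integrable \<mu> (\<lambda>y. ?d y *\<^sub>R g y)"
        unfolding eq by (intro Bochner_Integration.integrable_diff integrable_scaleR_right int \<psi>g)
      have "exp (lam * t) *\<^sub>R kernel_op \<mu> (u t) g x - (\<phi> x / overlap) *\<^sub>R (\<integral>y. \<psi> y *\<^sub>R g y \<partial>\<mu>)
          = (\<integral>y. ?d y *\<^sub>R g y \<partial>\<mu>)"
        unfolding eq kernel_op_def using int \<psi>g
        by (subst Bochner_Integration.integral_diff) (auto intro!: integrable_scaleR_right simp del: scaleR_scaleR)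
      also have "norm \<dots> \<le> (\<integral>y. norm (?d y *\<^sub>R g y) \<partial>\<mu>)"
        by (rule integral_norm_bound)
      also have "\<dots> \<le> (\<integral>y. (C * exp (- \<gamma> * t)) * norm (g y) \<partial>\<mu>)"
        using elim(1) by (intro integral_mono_AE integrable_norm d_int integrable_mult_right g)
          (auto intro!: mult_right_mono elim!: eventually_mono)
      finally show ?case
        using int by simp
    qed
  qed
  with C(1) show ?thesis
    by (rule that)
qed

lemma kernel_op_of_real:
  "kernel_op \<mu> k (\<lambda>y. complex_of_real (f y)) x = complex_of_real (kernel_op \<mu> k f x)"
proof -
  have "(\<lambda>y. k x y *\<^sub>R complex_of_real (f y)) = (\<lambda>y. complex_of_real (k x y *\<^sub>R f y))"
    by (simp add: scaleR_conv_of_real fun_eq_iff)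
  then show ?thesis
    unfolding kernel_op_def by (simp only: integral_complex_of_real)
qed

text \<open>
  The eigenvalue equation is contained in the convergence of the kernels. For the indicator function
  \<open>g\<close> of a set of positive finite measure, the functions \<open>g\<^sub>r = e\<^bsup>\<lambda>r\<^esup> U\<^sub>r g\<close> converge in $L^\infty$ to a
  positive multiple \<open>c \<phi>\<close> of \<open>\<phi>\<close> as \<open>r \<rightarrow> \<infinity>\<close>. By the semigroup law, \<open>e\<^bsup>\<lambda>t\<^esup> U\<^sub>t g\<^sub>r = g\<^bsub>r+t\<^esub>\<close>, and \<open>U\<^sub>t\<close> is bounded on
  $L^\infty$, so the limit satisfies \<open>e\<^bsup>\<lambda>t\<^esup> U\<^sub>t \<phi> = \<phi>\<close>.
\<close>

lemma eigenfunction: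
  assumes t: "t > 0"
  shows "AE x in \<mu>. kernel_op \<mu> (u t) \<phi> x = exp (- lam * t) * \<phi> x"
proof -
  obtain A where A[measurable]: "A \<in> sets \<mu>" and A_fin: "emeasure \<mu> A < \<infinity>" and A_pos: "emeasure \<mu> A \<noteq> 0"
  proof -
    obtain U where U: "open U" "emeasure \<mu> U < \<infinity>" "undefined \<in> U"
      using locally_finite unfolding locally_finite_measure_def by blast
    then have "0 < emeasure \<mu> U"
      using full_support by (auto simp: measure_support_def)
    then show thesis
      using that[of U] U by (auto simp: sets_eq)
  qed
  obtain C where C: "C > 0"
    "\<And>t g. t > 2 * t\<^sub>0 \<Longrightarrow> integrable \<mu> (g :: 'a \<Rightarrow> complex) \<Longrightarrow>
      AE x in \<mu>. integrable \<mu> (\<lambda>y. u t x y *\<^sub>R g y) \<and>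
        norm (exp (lam * t) *\<^sub>R kernel_op \<mu> (u t) g x - (\<phi> x / overlap) *\<^sub>R (\<integral>y. \<psi> y *\<^sub>R g y \<partial>\<mu>))
          \<le> C * exp (- \<gamma> * t) * (\<integral>y. norm (g y) \<partial>\<mu>)"
    using L1_Linfty_rate[where 'b = complex] by blast
  define g :: "'a \<Rightarrow> complex" where "g = (\<lambda>y. complex_of_real (indicator A y))"
  define m where "m = (\<integral>y. norm (g y) \<partial>\<mu>)"
  define c where "c = (\<integral>y. \<psi> y * indicator A y \<partial>\<mu>) / overlap"
  have g_L2: "g \<in> Lp \<mu> 2"
    by (rule bounded_finite_support_in_L2[OF _ A A_fin, of _ 1]) (auto simp: g_def)
  have g_meas[measurable]: "g \<in> borel_measurable \<mu>"
    by (simp add: g_def)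
  have g_int: "integrable \<mu> g"
    using A_fin unfolding g_def by (simp add: complex_of_real_integrable_eq)
  have \<psi>A: "integrable \<mu> (\<lambda>y. \<psi> y * indicator A y)"
  proof -
    obtain b where b: "b > 0" "\<And>x. \<psi> x \<le> b" using \<psi>_bound by blast
    have "integrable \<mu> (\<lambda>y. b * indicator A y :: real)"
      using A_fin by simp
    then show ?thesis
      by (rule Bochner_Integration.integrable_bound)
        (use b \<psi>_nonneg in \<open>auto split: split_indicator\<close>)
  qed
  have c_pos: "c > 0"
  proof -
    have "(\<integral>y. \<psi> y * indicator A y \<partial>\<mu>) \<noteq> 0"
    proof
      assume "(\<integral>y. \<psi> y * indicator A y \<partial>\<mu>) = 0"
      then have "AE y in \<mu>. \<psi> y * indicator A y = 0"
        using \<psi>A \<psi>_nonneg by (subst (asm) integral_nonneg_eq_0_iff_AE) auto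
      then have "AE y in \<mu>. y \<notin> A"
        using \<psi>_pos by eventually_elim (auto split: split_indicator_asm)
      then show False
        using A_pos A by (simp add: AE_iff_measurable[OF A])
    qed
    moreover have "0 \<le> (\<integral>y. \<psi> y * indicator A y \<partial>\<mu>)"
      using \<psi>_nonneg by (intro integral_nonneg_AE) auto
    ultimately show ?thesis
      using overlap_pos by (simp add: c_def)
  qed
  have c_eq: "(\<phi> x / overlap) *\<^sub>R (\<integral>y. \<psi> y *\<^sub>R g y \<partial>\<mu>) = complex_of_real (c * \<phi> x)" for x
  proof -
    have "(\<lambda>y. \<psi> y *\<^sub>R g y) = (\<lambda>y. complex_of_real (\<psi> y * indicator A y))"
      by (simp add: g_def scaleR_conv_of_real fun_eq_iff)
    then have "(\<integral>y. \<psi> y *\<^sub>R g y \<partial>\<mu>) = complex_of_real (\<integral>y. \<psi> y * indicator A y \<partial>\<mu>)"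
      by (simp only: integral_complex_of_real)
    then show ?thesis
      by (simp add: c_def scaleR_conv_of_real)
  qed
  have conv: "AE x in \<mu>. cmod (exp (lam * r) *\<^sub>R kernel_op \<mu> (u r) g x - complex_of_real (c * \<phi> x))
      \<le> C * exp (- \<gamma> * r) * m" if "r > 2 * t\<^sub>0" for r
    using C(2)[OF that g_int] unfolding c_eq m_def by (auto elim!: eventually_mono)
  define r where "r n = 2 * t\<^sub>0 + 1 + real n" for n :: nat
  have r: "r n > 2 * t\<^sub>0" "r n > 0" "t + r n > 2 * t\<^sub>0" for n
    using t t0_pos by (auto simp: r_def)
  define d where "d n y = exp (lam * r n) *\<^sub>R kernel_op \<mu> (u (r n)) g y - complex_of_real (c * \<phi> y)" for n y
  have d_meas[measurable]: "d n \<in> borel_measurable \<mu>" for n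
    unfolding d_def using kernel_op_measurable[OF r(2) g_meas] by measurable
  obtain b where b: "b > 0" "\<And>x. \<phi> x \<le> b" using \<phi>_bound by blast
  have step1: "AE x in \<mu>. \<forall>n. integrable \<mu> (\<lambda>y. u t x y *\<^sub>R d n y) \<and>
      cmod (kernel_op \<mu> (u t) (d n) x) \<le> C * exp (- \<gamma> * r n) * m * mass t x"
    unfolding AE_all_countable
    using kernel_op_bounded[OF t d_meas] conv[OF r(1)] unfolding d_def by blast
  have step2: "AE x in \<mu>. \<forall>n. cmod (exp (lam * (t + r n)) *\<^sub>R kernel_op \<mu> (u (t + r n)) g x - complex_of_real (c * \<phi> x))
      \<le> C * exp (- \<gamma> * (t + r n)) * m"
    unfolding AE_all_countable using conv[OF r(3)] by blast
  have step3: "AE x in \<mu>. \<forall>n. kernel_op \<mu> (u (t + r n)) g x = kernel_op \<mu> (u t) (kernel_op \<mu> (u (r n)) g) x"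
    unfolding AE_all_countable
    using semigroup g_L2 t r(2) unfolding L2_semigroup_def sg_def
    by (auto simp: add_pos_pos less_imp_neq[THEN not_sym])
  have step4: "AE x in \<mu>. integrable \<mu> (\<lambda>y. u t x y *\<^sub>R complex_of_real (\<phi> y))"
    using kernel_op_bounded[OF t, of "\<lambda>y. complex_of_real (\<phi> y)" b] b(2) \<phi>_nonneg
    by (auto elim!: eventually_mono)
  have "AE x in \<mu>. exp (lam * t) * (c * kernel_op \<mu> (u t) \<phi> x) = c * \<phi> x"
    using step1 step2 step3 step4
  proof eventually_elim
    case (elim x)
    define L where "L = complex_of_real (exp (lam * t) * (c * kernel_op \<mu> (u t) \<phi> x) - c * \<phi> x)"
    define B where "B = exp (lam * t) * C * m * mass t x + C * exp (- \<gamma> * t) * m"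
    \<comment> \<open>\<open>L\<close> does not depend on \<open>n\<close>, whereas both errors committed in comparing it with the \<open>n\<close>-th function decay.\<close>
    have "cmod L \<le> exp (- \<gamma> * r n) * B" for n
    proof -
      let ?V = "kernel_op \<mu> (u (t + r n)) g x"
      have d_int: "integrable \<mu> (\<lambda>y. u t x y *\<^sub>R d n y)"
        using elim(1) by blast
      have \<phi>_int: "integrable \<mu> (\<lambda>y. c *\<^sub>R (u t x y *\<^sub>R complex_of_real (\<phi> y)))"
        using elim(4) by (rule integrable_scaleR_right)
      have split: "exp (lam * r n) *\<^sub>R (u t x y *\<^sub>R kernel_op \<mu> (u (r n)) g y)
          = u t x y *\<^sub>R d n y + c *\<^sub>R (u t x y *\<^sub>R complex_of_real (\<phi> y))" for y
        by (simp add: d_def scaleR_conv_of_real algebra_simps)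
      have "exp (lam * r n) *\<^sub>R ?V = (\<integral>y. exp (lam * r n) *\<^sub>R (u t x y *\<^sub>R kernel_op \<mu> (u (r n)) g y) \<partial>\<mu>)"
        using elim(3) by (simp add: kernel_op_def[of _ "u t"] del: scaleR_scaleR)
      also have "\<dots> = kernel_op \<mu> (u t) (d n) x + c *\<^sub>R kernel_op \<mu> (u t) (\<lambda>y. complex_of_real (\<phi> y)) x"
        unfolding split kernel_op_def[of \<mu> "u t"] using d_int \<phi>_int
        by (subst Bochner_Integration.integral_add) (simp_all del: scaleR_scaleR)
      finally have V: "exp (lam * r n) *\<^sub>R ?V
          = kernel_op \<mu> (u t) (d n) x + complex_of_real (c * kernel_op \<mu> (u t) \<phi> x)"
        by (simp add: kernel_op_of_real scaleR_conv_of_real)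
      have "exp (lam * (t + r n)) *\<^sub>R ?V = exp (lam * t) *\<^sub>R (exp (lam * r n) *\<^sub>R ?V)"
        by (simp add: distrib_left exp_add)
      then have "L = (exp (lam * (t + r n)) *\<^sub>R ?V - complex_of_real (c * \<phi> x))
          - exp (lam * t) *\<^sub>R kernel_op \<mu> (u t) (d n) x"
        unfolding V L_def by (simp add: scaleR_conv_of_real algebra_simps)
      also have "cmod \<dots> \<le> cmod (exp (lam * (t + r n)) *\<^sub>R ?V - complex_of_real (c * \<phi> x))
          + exp (lam * t) * cmod (kernel_op \<mu> (u t) (d n) x)"
        by (rule order_trans[OF norm_triangle_ineq4]) simp
      also have "\<dots> \<le> C * exp (- \<gamma> * (t + r n)) * m
          + exp (lam * t) * (C * exp (- \<gamma> * r n) * m * mass t x)"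
        using elim(1,2) by (intro add_mono mult_left_mono) auto
      also have "\<dots> = exp (- \<gamma> * r n) * B"
        by (simp add: B_def algebra_simps exp_add[symmetric] exp_diff)
      finally show ?thesis .
    qed
    moreover have "(\<lambda>n. exp (- \<gamma> * r n) * B) \<longlonglongrightarrow> 0"
      unfolding r_def using \<gamma>_pos by real_asymp
    ultimately have "cmod L \<le> 0"
      by (intro LIMSEQ_le_const[of _ 0]) auto
    then have "L = 0"
      by simp
    then show ?case
      unfolding L_def of_real_eq_0_iff by simp
  qed
  then show ?thesis
  proof eventually_elim
    case (elim x)
    then have "exp (lam * t) * kernel_op \<mu> (u t) \<phi> x = \<phi> x"
      using c_pos by simp
    then show ?case
      by (simp add: exp_minus field_simps)
  qed
qed

lemma dual_eigenfunction:
  assumes t: "t > 0"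
  shows "AE y in \<mu>. integrable \<mu> (\<lambda>x. u t x y * \<psi> x)"
    and "AE y in \<mu>. (\<integral>x. u t x y * \<psi> x \<partial>\<mu>) = exp (- lam * t) * \<psi> y"
proof -
  interpret D: ground_state_kernel \<mu> "transposed u" t\<^sub>0 lam \<gamma> \<psi> \<phi> by (rule dual)
  obtain b where b: "b > 0" "\<And>x. \<psi> x \<le> b" using \<psi>_bound by blast
  show "AE y in \<mu>. integrable \<mu> (\<lambda>x. u t x y * \<psi> x)"
    using D.kernel_op_bounded[OF t \<psi>_measurable, of b] b \<psi>_nonneg
    by (auto simp: transposed_def elim!: eventually_mono)
  show "AE y in \<mu>. (\<integral>x. u t x y * \<psi> x \<partial>\<mu>) = exp (- lam * t) * \<psi> y"
    using D.eigenfunction[OF t] by (simp add: kernel_op_def transposed_def)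
qed

text \<open>
  In particular \<open>\<psi>\<mu>\<close> is invariant under the semigroup up to the factor \<open>e\<^bsup>-\<lambda>t\<^esup>\<close>, which is what makes
  its normalization quasi-stationary.
\<close>

lemma integral_\<psi>_kernel_op:
  fixes f :: "'a \<Rightarrow> 'b::{banach, second_countable_topology}"
  assumes t: "t > 0" and f: "f \<in> borel_measurable \<mu>" and int: "integrable \<mu> (\<lambda>y. \<psi> y *\<^sub>R f y)"
  shows "integrable \<mu> (\<lambda>x. \<psi> x *\<^sub>R kernel_op \<mu> (u t) f x)"
    and "(\<integral>x. \<psi> x *\<^sub>R kernel_op \<mu> (u t) f x \<partial>\<mu>) = exp (- lam * t) *\<^sub>R (\<integral>y. \<psi> y *\<^sub>R f y \<partial>\<mu>)"
proof -
  interpret D: ground_state_kernel \<mu> "transposed u" t\<^sub>0 lam \<gamma> \<psi> \<phi> by (rule dual)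
  have [measurable]: "(\<lambda>y. \<integral>x. u t x y * \<psi> x \<partial>\<mu>) \<in> borel_measurable \<mu>"
    using D.kernel_op_measurable[OF t \<psi>_measurable] by (simp add: kernel_op_def transposed_def)
  note [measurable] = f
  have ae: "AE y in \<mu>. (\<integral>x. u t x y * \<psi> x \<partial>\<mu>) *\<^sub>R f y = exp (- lam * t) *\<^sub>R (\<psi> y *\<^sub>R f y)"
    using dual_eigenfunction(2)[OF t] by eventually_elim simp
  have int': "integrable \<mu> (\<lambda>y. exp (- lam * t) *\<^sub>R (\<psi> y *\<^sub>R f y))"
    using int by (rule integrable_scaleR_right)
  have "integrable \<mu> (\<lambda>y. (\<integral>x. u t x y * \<psi> x \<partial>\<mu>) *\<^sub>R f y)"
    by (subst integrable_cong_AE[OF _ _ ae]) (use int' in measurable)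
  note * = kernel_op_duality[OF t f \<psi>_measurable \<psi>_pos dual_eigenfunction(1)[OF t] this]
  show "integrable \<mu> (\<lambda>x. \<psi> x *\<^sub>R kernel_op \<mu> (u t) f x)"
    by (rule *(2))
  have "(\<integral>y. (\<integral>x. u t x y * \<psi> x \<partial>\<mu>) *\<^sub>R f y \<partial>\<mu>) = (\<integral>y. exp (- lam * t) *\<^sub>R (\<psi> y *\<^sub>R f y) \<partial>\<mu>)"
    by (rule integral_cong_AE[OF _ _ ae]) measurable
  then show "(\<integral>x. \<psi> x *\<^sub>R kernel_op \<mu> (u t) f x \<partial>\<mu>) = exp (- lam * t) *\<^sub>R (\<integral>y. \<psi> y *\<^sub>R f y \<partial>\<mu>)"
    unfolding *(3) by (simp del: scaleR_scaleR)
qed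

end

section \<open>Finite heat content\<close>

text \<open>
  The estimates are uniform in the exponent, so the unit balls of all $L^p$ with \<open>p \<ge> 1\<close> are treated together.
\<close>

definition Lp_unit_balls :: "'a measure \<Rightarrow> ('a \<Rightarrow> 'b::real_normed_vector) set" where
  "Lp_unit_balls \<mu> = (\<Union>p\<in>{1..}. {f \<in> Lp \<mu> p. Lp_norm \<mu> p f \<le> 1})"

lemma Lp_unit_balls_measurable: "f \<in> Lp_unit_balls \<mu> \<Longrightarrow> f \<in> borel_measurable \<mu>"
  by (auto simp: Lp_unit_balls_def Lp_def)

lemma bounded_in_Lp_unit_balls:
  fixes f :: "'a \<Rightarrow> 'b::real_normed_vector"
  assumes f[measurable]: "f \<in> borel_measurable \<mu>" and le: "\<And>x. norm (f x) \<le> 1"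
  shows "f \<in> Lp_unit_balls \<mu>" and "Lp_norm \<mu> \<infinity> f \<le> 1"
proof -
  show "Lp_norm \<mu> \<infinity> f \<le> 1"
    using le by (auto simp: Lp_norm_def intro!: esssup_I)
  moreover have "f \<in> Lp \<mu> \<infinity>"
    unfolding Lp_infinity_iff using le by (auto intro!: exI[of _ 1])
  ultimately show "f \<in> Lp_unit_balls \<mu>"
    unfolding Lp_unit_balls_def by (intro UN_I[of \<infinity>]) auto
qed

lemma integrable_weight_Lp_unit_balls:
  fixes f :: "'a \<Rightarrow> 'b::{banach, second_countable_topology}" and w :: "'a \<Rightarrow> real"
  assumes f: "f \<in> Lp_unit_balls \<mu>" and w: "integrable \<mu> w"
    and w_nonneg: "AE x in \<mu>. 0 \<le> w x" and b: "0 \<le> b" and w_le: "AE x in \<mu>. w x \<le> b"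
  shows "integrable \<mu> (\<lambda>x. w x *\<^sub>R f x)"
    and "(\<integral>x. norm (w x *\<^sub>R f x) \<partial>\<mu>) \<le> (\<integral>x. w x \<partial>\<mu>) + b"
    and "norm (\<integral>x. w x *\<^sub>R f x \<partial>\<mu>) \<le> (\<integral>x. w x \<partial>\<mu>) + b"
proof -
  have [measurable]: "f \<in> borel_measurable \<mu>" "w \<in> borel_measurable \<mu>"
    using Lp_unit_balls_measurable[OF f] w by auto
  obtain p where p: "1 \<le> p" "f \<in> Lp \<mu> p" "Lp_norm \<mu> p f \<le> 1"
    using f by (auto simp: Lp_unit_balls_def)
  have w_int: "0 \<le> (\<integral>x. w x \<partial>\<mu>)"
    using w_nonneg by (rule integral_nonneg_AE)
  have "(\<integral>\<^sup>+x. ennreal (norm (w x *\<^sub>R f x)) \<partial>\<mu>) = (\<integral>\<^sup>+x. ennreal (w x) * ennreal (norm (f x)) \<partial>\<mu>)"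
    by (rule nn_integral_cong_AE, use w_nonneg in eventually_elim) (simp add: ennreal_mult)
  also have "\<dots> \<le> ennreal (\<integral>x. w x \<partial>\<mu>) + ennreal b"
    using p by (rule nn_integral_weight_Lp_le)
      (use w_le w w_nonneg in \<open>auto simp: nn_integral_eq_integral intro: ennreal_leI elim!: eventually_mono\<close>)
  also have "\<dots> = ennreal ((\<integral>x. w x \<partial>\<mu>) + b)"
    using w_int b by simp
  finally have le: "(\<integral>\<^sup>+x. ennreal (norm (w x *\<^sub>R f x)) \<partial>\<mu>) \<le> ennreal ((\<integral>x. w x \<partial>\<mu>) + b)" .
  show int: "integrable \<mu> (\<lambda>x. w x *\<^sub>R f x)"
    by (rule integrableI_bounded) (use order_le_less_trans[OF le ennreal_less_top] in auto)
  have "ennreal (\<integral>x. norm (w x *\<^sub>R f x) \<partial>\<mu>) \<le> ennreal ((\<integral>x. w x \<partial>\<mu>) + b)"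
    using le nn_integral_eq_integral[OF integrable_norm[OF int]] by (simp del: norm_scaleR)
  then show le': "(\<integral>x. norm (w x *\<^sub>R f x) \<partial>\<mu>) \<le> (\<integral>x. w x \<partial>\<mu>) + b"
    using w_int b by (simp del: norm_scaleR ennreal_plus)
  show "norm (\<integral>x. w x *\<^sub>R f x \<partial>\<mu>) \<le> (\<integral>x. w x \<partial>\<mu>) + b"
    by (rule order_trans[OF integral_norm_bound le'])
qed

locale finite_heat_kernel = ground_state_kernel \<mu> u t\<^sub>0 lam \<gamma> \<phi> \<psi>
  for \<mu> :: "'a::polish_space measure" and u t\<^sub>0 lam \<gamma> \<phi> \<psi> +
  fixes t\<^sub>1 :: real
  assumes t0_le_t1: "t\<^sub>0 \<le> t\<^sub>1"
    and heat: "heat_content \<mu> u t\<^sub>1 < \<infinity>"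
begin

lemma t1_pos: "t\<^sub>1 > 0"
  using t0_pos t0_le_t1 by simp

lemma dual_heat: "finite_heat_kernel \<mu> (transposed u) t\<^sub>0 lam \<gamma> \<psi> \<phi> t\<^sub>1"
proof -
  interpret D: ground_state_kernel \<mu> "transposed u" t\<^sub>0 lam \<gamma> \<psi> \<phi> by (rule dual)
  interpret pair_sigma_finite \<mu> \<mu> by (rule pair_sigma_finite)
  note kernel_measurable[OF t1_pos, measurable]
  have "heat_content \<mu> (transposed u) t\<^sub>1 = (\<integral>\<^sup>+y. \<integral>\<^sup>+x. ennreal (u t\<^sub>1 x y) \<partial>\<mu> \<partial>\<mu>)"
    unfolding D.heat_content_eq[OF t1_pos] by (simp add: transposed_def)
  also have "\<dots> = (\<integral>\<^sup>+x. \<integral>\<^sup>+y. ennreal (u t\<^sub>1 x y) \<partial>\<mu> \<partial>\<mu>)"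
    by (rule Fubini') measurable
  also have "\<dots> = heat_content \<mu> u t\<^sub>1"
    by (simp add: heat_content_eq[OF t1_pos])
  finally show ?thesis
    using heat t0_le_t1 by unfold_locales auto
qed

lemma mass_nonneg:
  assumes "t > 0"
  shows "AE x in \<mu>. 0 \<le> mass t x"
  using kernel_nonneg[OF assms] by eventually_elim (rule integral_nonneg_AE)

lemma mass_eq: "kernel_op \<mu> (u t) (\<lambda>_. 1 :: real) = mass t"
  by (simp add: kernel_op_def fun_eq_iff)

lemma mass_measurable: "t > 0 \<Longrightarrow> mass t \<in> borel_measurable \<mu>"
  using kernel_op_measurable[of t "\<lambda>_. 1 :: real"] by (simp add: mass_eq)

lemma mass_integrable: "integrable \<mu> (mass t\<^sub>1)"
proof (rule integrableI_bounded)
  have "(\<integral>\<^sup>+x. ennreal (norm (mass t\<^sub>1 x)) \<partial>\<mu>) = heat_content \<mu> u t\<^sub>1"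
    unfolding heat_content_def
    by (rule nn_integral_cong_AE, use mass_nonneg[OF t1_pos] in eventually_elim)
      (use t1_pos in \<open>simp add: sg_def kernel_op_def\<close>)
  then show "(\<integral>\<^sup>+x. ennreal (norm (mass t\<^sub>1 x)) \<partial>\<mu>) < \<infinity>"
    using heat by simp
qed (rule mass_measurable[OF t1_pos])

text \<open>
  \<open>\<phi> = e\<^bsup>\<lambda>t\<^sub>1\<^esup> U\<^bsub>t\<^sub>1\<^esub> \<phi>\<close> is dominated by a multiple of \<open>U\<^bsub>t\<^sub>1\<^esub> 1\<close>, whose integral is the heat content.
\<close>

lemma \<phi>_integrable: "integrable \<mu> \<phi>"
proof -
  obtain b where b: "b > 0" "\<And>x. \<phi> x \<le> b" using \<phi>_bound by blast
  have "integrable \<mu> (\<lambda>x. exp (lam * t\<^sub>1) * (b * mass t\<^sub>1 x))"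
    by (intro integrable_mult_right mass_integrable)
  then show ?thesis
  proof (rule Bochner_Integration.integrable_bound)
    have "AE x in \<mu>. integrable \<mu> (\<lambda>y. u t\<^sub>1 x y *\<^sub>R \<phi> y) \<and> norm (kernel_op \<mu> (u t\<^sub>1) \<phi> x) \<le> b * mass t\<^sub>1 x"
      using b \<phi>_nonneg by (intro kernel_op_bounded t1_pos) auto
    with eigenfunction[OF t1_pos]
    show "AE x in \<mu>. norm (\<phi> x) \<le> norm (exp (lam * t\<^sub>1) * (b * mass t\<^sub>1 x))"
    proof eventually_elim
      case (elim x)
      have "\<phi> x = exp (lam * t\<^sub>1) * kernel_op \<mu> (u t\<^sub>1) \<phi> x"
        using elim(1) by (simp add: exp_minus field_simps)
      also have "\<dots> \<le> exp (lam * t\<^sub>1) * (b * mass t\<^sub>1 x)"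
        using elim(2) by (intro mult_left_mono) auto
      finally show ?case
        using \<phi>_nonneg[of x] by (simp only: real_norm_def)
    qed
  qed (rule \<phi>_measurable)
qed

lemma \<psi>_integrable: "integrable \<mu> \<psi>"
  using finite_heat_kernel.\<phi>_integrable[OF dual_heat] .

lemma integral_\<psi>_pos: "0 < (\<integral>x. \<psi> x \<partial>\<mu>)"
  using \<psi>_integrable \<psi>_pos by (rule integral_pos_AE)

text \<open>
  Finite heat content gives more than $L^1$ bounds for \<open>U\<^bsub>t\<^sub>1\<^esub>\<close> on $L^\infty$: since the function
  \<open>y \<mapsto> \<integral> u\<^bsub>t\<^sub>1\<^esub>(x, y) \<mu>(dx)\<close> is bounded and integrable, \<open>U\<^bsub>t\<^sub>1\<^esub>\<close> maps every $L^p$ into $L^1$.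
\<close>

lemma Lp_L1_bound:
  obtains K where "0 \<le> K"
    "\<And>f :: 'a \<Rightarrow> complex. f \<in> Lp_unit_balls \<mu> \<Longrightarrow>
      (AE z in \<mu>. integrable \<mu> (\<lambda>y. u t\<^sub>1 z y *\<^sub>R f y)) \<and>
      integrable \<mu> (\<lambda>z. \<integral>y. norm (u t\<^sub>1 z y *\<^sub>R f y) \<partial>\<mu>) \<and>
      integrable \<mu> (kernel_op \<mu> (u t\<^sub>1) f) \<and> (\<integral>z. norm (kernel_op \<mu> (u t\<^sub>1) f z) \<partial>\<mu>) \<le> K"
proof -
  interpret D: finite_heat_kernel \<mu> "transposed u" t\<^sub>0 lam \<gamma> \<psi> \<phi> t\<^sub>1 by (rule dual_heat)
  interpret sigma_finite_measure \<mu> by (rule sigma_finite)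
  obtain c where c: "0 \<le> c" "AE y in \<mu>. D.mass t\<^sub>1 y \<le> c"
    using D.mass_bounded[OF t1_pos] by blast
  define K where "K = (\<integral>y. D.mass t\<^sub>1 y \<partial>\<mu>) + c"
  note [measurable] = kernel_measurable'[OF t1_pos] D.mass_measurable[OF t1_pos]
  have col_int: "AE y in \<mu>. integrable \<mu> (\<lambda>x. u t\<^sub>1 x y * 1)"
    using D.kernel_row_integrable[OF t1_pos] by (simp add: transposed_def)
  have col_mass: "D.mass t\<^sub>1 y = (\<integral>x. u t\<^sub>1 x y * 1 \<partial>\<mu>)" for y
    by (simp add: transposed_def)
  have "(AE z in \<mu>. integrable \<mu> (\<lambda>y. u t\<^sub>1 z y *\<^sub>R f y)) \<and>
      integrable \<mu> (\<lambda>z. \<integral>y. norm (u t\<^sub>1 z y *\<^sub>R f y) \<partial>\<mu>) \<and>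
      integrable \<mu> (kernel_op \<mu> (u t\<^sub>1) f) \<and> (\<integral>z. norm (kernel_op \<mu> (u t\<^sub>1) f z) \<partial>\<mu>) \<le> K"
    if f: "f \<in> Lp_unit_balls \<mu>" for f :: "'a \<Rightarrow> complex"
  proof -
    have [measurable]: "f \<in> borel_measurable \<mu>"
      using f by (rule Lp_unit_balls_measurable)
    note w = f D.mass_integrable D.mass_nonneg[OF t1_pos] c
    have int: "integrable \<mu> (\<lambda>y. D.mass t\<^sub>1 y *\<^sub>R f y)"
      and le: "(\<integral>y. norm (D.mass t\<^sub>1 y *\<^sub>R f y) \<partial>\<mu>) \<le> K"
      unfolding K_def using integrable_weight_Lp_unit_balls[OF w] by blast+
    have eq: "AE y in \<mu>. norm (D.mass t\<^sub>1 y *\<^sub>R f y) = D.mass t\<^sub>1 y *\<^sub>R norm (f y)"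
      using D.mass_nonneg[OF t1_pos] by eventually_elim simp
    have int': "integrable \<mu> (\<lambda>y. D.mass t\<^sub>1 y *\<^sub>R norm (f y))"
      by (subst integrable_cong_AE[OF _ _ AE_symmetric[OF eq]])
        (use integrable_norm[OF int] D.mass_measurable[OF t1_pos] in measurable)
    note dual_f = kernel_op_duality[OF t1_pos _ _ _ col_int int[unfolded col_mass], simplified]
    note dual_n = kernel_op_duality[OF t1_pos _ _ _ col_int int'[unfolded col_mass], simplified]
    let ?G = "\<lambda>z. \<integral>y. norm (u t\<^sub>1 z y *\<^sub>R f y) \<partial>\<mu>"
    have G: "AE z in \<mu>. ?G z = kernel_op \<mu> (u t\<^sub>1) (\<lambda>y. norm (f y)) z"
      using kernel_nonneg[OF t1_pos]
    proof eventually_elim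
      case (elim z)
      note [measurable] = kernel_row_measurable[OF t1_pos, of z]
      show ?case
        unfolding kernel_op_def by (rule integral_cong_AE) (use elim in \<open>auto elim!: eventually_mono\<close>)
    qed
    have G_meas: "?G \<in> borel_measurable \<mu>"
      by (rule borel_measurable_lebesgue_integral) (simp add: split_beta')
    have N_meas: "kernel_op \<mu> (u t\<^sub>1) (\<lambda>y. norm (f y)) \<in> borel_measurable \<mu>"
      by (rule kernel_op_measurable[OF t1_pos]) measurable
    have G_int: "integrable \<mu> ?G"
      using dual_n(2) by (subst integrable_cong_AE[OF G_meas N_meas G]) auto
    have "(\<integral>z. norm (kernel_op \<mu> (u t\<^sub>1) f z) \<partial>\<mu>) \<le> (\<integral>z. ?G z \<partial>\<mu>)"
      using dual_f(2) G_int unfolding kernel_op_def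
      by (intro integral_mono integrable_norm integral_norm_bound) auto
    also have "\<dots> = (\<integral>z. kernel_op \<mu> (u t\<^sub>1) (\<lambda>y. norm (f y)) z \<partial>\<mu>)"
      by (rule integral_cong_AE[OF G_meas N_meas G])
    also have "\<dots> = (\<integral>y. D.mass t\<^sub>1 y *\<^sub>R norm (f y) \<partial>\<mu>)"
      using dual_n(3) by (simp add: transposed_def)
    also have "\<dots> = (\<integral>y. norm (D.mass t\<^sub>1 y *\<^sub>R f y) \<partial>\<mu>)"
      by (rule integral_cong_AE) (use int int' eq in \<open>auto elim!: eventually_mono\<close>)
    finally have "(\<integral>z. norm (kernel_op \<mu> (u t\<^sub>1) f z) \<partial>\<mu>) \<le> K"
      using le by simp
    then show ?thesis
      using dual_f(1,2) G_int by simp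
  qed
  moreover have "0 \<le> K"
    unfolding K_def using c(1) integral_nonneg_AE[OF D.mass_nonneg[OF t1_pos]] by simp
  ultimately show ?thesis
    using that by blast
qed

text \<open>
  At late times the rows \<open>u\<^sub>t(x, \<cdot>)\<close> of the kernel are bounded and integrable uniformly in \<open>x\<close>.
\<close>

lemma Lp_Linfty_bound:
  assumes t: "t > 2 * t\<^sub>0"
  obtains D where "D \<ge> 0"
    "\<And>f :: 'a \<Rightarrow> complex. f \<in> Lp_unit_balls \<mu> \<Longrightarrow>
      AE x in \<mu>. integrable \<mu> (\<lambda>y. u t x y *\<^sub>R f y) \<and> (\<integral>y. norm (u t x y *\<^sub>R f y) \<partial>\<mu>) \<le> D"
proof -
  have t': "t > 0"
    using t t0_pos by simp
  obtain d where d: "d \<ge> 0" "AE x in \<mu>. AE y in \<mu>. \<bar>u t x y\<bar> \<le> d"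
    using kernel_row_bound[OF t] by blast
  obtain c where c: "0 \<le> c" "AE x in \<mu>. mass t x \<le> c"
    using mass_bounded[OF t'] by blast
  have "AE x in \<mu>. integrable \<mu> (\<lambda>y. u t x y *\<^sub>R f y) \<and> (\<integral>y. norm (u t x y *\<^sub>R f y) \<partial>\<mu>) \<le> c + d"
    if f: "f \<in> Lp_unit_balls \<mu>" for f :: "'a \<Rightarrow> complex"
    using d(2) c(2) kernel_row_integrable[OF t'] kernel_nonneg[OF t']
  proof eventually_elim
    case (elim x)
    have "AE y in \<mu>. u t x y \<le> d"
      using elim(1) by (auto elim!: eventually_mono)
    note * = integrable_weight_Lp_unit_balls[OF f elim(3,4) d(1) this]
    show ?case
      using *(1,2) elim(2) by linarith
  qed
  then show ?thesis
    using c(1) d(1) that[of "c + d"] by simp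
qed

lemma \<psi>_weight:
  obtains b where "b \<ge> 0"
    "\<And>f :: 'a \<Rightarrow> complex. f \<in> Lp_unit_balls \<mu> \<Longrightarrow>
      integrable \<mu> (\<lambda>x. \<psi> x *\<^sub>R f x) \<and> norm (\<integral>x. \<psi> x *\<^sub>R f x \<partial>\<mu>) \<le> b"
proof -
  obtain b where b: "b > 0" "\<And>x. \<psi> x \<le> b" using \<psi>_bound by blast
  have "integrable \<mu> (\<lambda>x. \<psi> x *\<^sub>R f x) \<and> norm (\<integral>x. \<psi> x *\<^sub>R f x \<partial>\<mu>) \<le> (\<integral>x. \<psi> x \<partial>\<mu>) + b"
    if f: "f \<in> Lp_unit_balls \<mu>" for f :: "'a \<Rightarrow> complex"
    using integrable_weight_Lp_unit_balls(1,3)[OF f \<psi>_integrable, of b] b \<psi>_nonneg by simp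
  then show ?thesis
    using that[of "(\<integral>x. \<psi> x \<partial>\<mu>) + b"] integral_\<psi>_pos b(1) by simp
qed

section \<open>Convergence to the ground state\<close>

text \<open>
  For \<open>f\<close> in $L^p$ one factors \<open>U\<^sub>\<tau> = U\<^bsub>\<tau>-t\<^sub>1\<^esub> U\<^bsub>t\<^sub>1\<^esub>\<close>: the second factor leads into $L^1$, where the uniform
  estimate of the kernels applies.
\<close>

lemma Lp_Linfty_rate:
  obtains C where "C > 0"
    "\<And>f :: 'a \<Rightarrow> complex. \<And>\<tau>. f \<in> Lp_unit_balls \<mu> \<Longrightarrow> \<tau> > t\<^sub>1 + 2 * t\<^sub>0 \<Longrightarrow>
      AE y in \<mu>. cmod (exp (lam * \<tau>) *\<^sub>R kernel_op \<mu> (u \<tau>) f y - (\<phi> y / overlap) *\<^sub>R (\<integral>z. \<psi> z *\<^sub>R f z \<partial>\<mu>))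
        \<le> C * exp (- \<gamma> * \<tau>)"
proof -
  obtain C where C: "C > 0"
    "\<And>t g. t > 2 * t\<^sub>0 \<Longrightarrow> integrable \<mu> (g :: 'a \<Rightarrow> complex) \<Longrightarrow>
      AE x in \<mu>. integrable \<mu> (\<lambda>y. u t x y *\<^sub>R g y) \<and>
        norm (exp (lam * t) *\<^sub>R kernel_op \<mu> (u t) g x - (\<phi> x / overlap) *\<^sub>R (\<integral>y. \<psi> y *\<^sub>R g y \<partial>\<mu>))
          \<le> C * exp (- \<gamma> * t) * (\<integral>y. norm (g y) \<partial>\<mu>)"
    using L1_Linfty_rate[where 'b = complex] by blast
  obtain CR where "CR > 0" and CR: "\<And>t g. t > 2 * t\<^sub>0 \<Longrightarrow> integrable \<mu> (g :: 'a \<Rightarrow> real) \<Longrightarrow>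
      AE x in \<mu>. integrable \<mu> (\<lambda>y. u t x y *\<^sub>R g y) \<and>
        norm (exp (lam * t) *\<^sub>R kernel_op \<mu> (u t) g x - (\<phi> x / overlap) *\<^sub>R (\<integral>y. \<psi> y *\<^sub>R g y \<partial>\<mu>))
          \<le> CR * exp (- \<gamma> * t) * (\<integral>y. norm (g y) \<partial>\<mu>)"
    using L1_Linfty_rate[where 'b = real] by blast
  obtain K where K: "0 \<le> K"
    "\<And>f :: 'a \<Rightarrow> complex. f \<in> Lp_unit_balls \<mu> \<Longrightarrow>
      (AE z in \<mu>. integrable \<mu> (\<lambda>y. u t\<^sub>1 z y *\<^sub>R f y)) \<and>
      integrable \<mu> (\<lambda>z. \<integral>y. norm (u t\<^sub>1 z y *\<^sub>R f y) \<partial>\<mu>) \<and>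
      integrable \<mu> (kernel_op \<mu> (u t\<^sub>1) f) \<and> (\<integral>z. norm (kernel_op \<mu> (u t\<^sub>1) f z) \<partial>\<mu>) \<le> K"
    using Lp_L1_bound by blast
  obtain b where b: "\<And>f :: 'a \<Rightarrow> complex. f \<in> Lp_unit_balls \<mu> \<Longrightarrow>
      integrable \<mu> (\<lambda>x. \<psi> x *\<^sub>R f x) \<and> norm (\<integral>x. \<psi> x *\<^sub>R f x \<partial>\<mu>) \<le> b"
    using \<psi>_weight by blast
  \<comment> \<open>The exponential compensates for the delay of the estimate by \<open>t\<^sub>1\<close>, and \<open>K + 1\<close> is positive even if \<open>K = 0\<close>.\<close>
  define C' where "C' = exp ((lam + \<gamma>) * t\<^sub>1) * C * (K + 1)"
  have "AE y in \<mu>. cmod (exp (lam * \<tau>) *\<^sub>R kernel_op \<mu> (u \<tau>) f y - (\<phi> y / overlap) *\<^sub>R (\<integral>z. \<psi> z *\<^sub>R f z \<partial>\<mu>))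
        \<le> C' * exp (- \<gamma> * \<tau>)"
    if f: "f \<in> Lp_unit_balls \<mu>" and \<tau>: "\<tau> > t\<^sub>1 + 2 * t\<^sub>0" for f :: "'a \<Rightarrow> complex" and \<tau>
  proof -
    define r where "r = \<tau> - t\<^sub>1"
    have r: "r > 2 * t\<^sub>0" "r > 0" "\<tau> = r + t\<^sub>1" "\<tau> > 2 * t\<^sub>0"
      using \<tau> t0_pos t1_pos by (auto simp: r_def)
    have f_meas: "f \<in> borel_measurable \<mu>"
      using f by (rule Lp_unit_balls_measurable)
    define g where "g = kernel_op \<mu> (u t\<^sub>1) f"
    have g: "integrable \<mu> g" "(\<integral>z. norm (g z) \<partial>\<mu>) \<le> K"
      using K(2)[OF f] by (auto simp: g_def)
    have add: "AE y in \<mu>. kernel_op \<mu> (u (r + t\<^sub>1)) f y = kernel_op \<mu> (u r) g y"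
      unfolding g_def
    proof (rule kernel_op_add[OF r(2) t1_pos f_meas])
      obtain D where "\<And>f :: 'a \<Rightarrow> complex. f \<in> Lp_unit_balls \<mu> \<Longrightarrow>
        AE x in \<mu>. integrable \<mu> (\<lambda>y. u \<tau> x y *\<^sub>R f y) \<and> (\<integral>y. norm (u \<tau> x y *\<^sub>R f y) \<partial>\<mu>) \<le> D"
        using Lp_Linfty_bound[OF r(4)] by blast
      then show "AE x in \<mu>. integrable \<mu> (\<lambda>y. u (r + t\<^sub>1) x y *\<^sub>R f y)"
        using f r(3) by (auto elim!: eventually_mono)
      show "AE z in \<mu>. integrable \<mu> (\<lambda>y. u t\<^sub>1 z y *\<^sub>R f y)"
        using K(2)[OF f] by blast
      show "AE x in \<mu>. integrable \<mu> (\<lambda>z. u r x z * (\<integral>y. norm (u t\<^sub>1 z y *\<^sub>R f y) \<partial>\<mu>))"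
        using CR[OF r(1), of "\<lambda>z. \<integral>y. norm (u t\<^sub>1 z y *\<^sub>R f y) \<partial>\<mu>"] K(2)[OF f] 
        by (auto elim!: eventually_mono)
    qed
    have \<psi>g: "(\<integral>z. \<psi> z *\<^sub>R g z \<partial>\<mu>) = exp (- lam * t\<^sub>1) *\<^sub>R (\<integral>z. \<psi> z *\<^sub>R f z \<partial>\<mu>)"
      unfolding g_def using b[OF f] by (intro integral_\<psi>_kernel_op t1_pos f_meas) auto
    show ?thesis
      using add C(2)[OF r(1) g(1)]
    proof eventually_elim
      case (elim y)
      have e: "exp (lam * t\<^sub>1) * exp (- lam * t\<^sub>1) = 1"
        by (simp flip: exp_add)
      have "exp (lam * \<tau>) *\<^sub>R kernel_op \<mu> (u \<tau>) f y - (\<phi> y / overlap) *\<^sub>R (\<integral>z. \<psi> z *\<^sub>R f z \<partial>\<mu>)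
          = exp (lam * t\<^sub>1) *\<^sub>R (exp (lam * r) *\<^sub>R kernel_op \<mu> (u r) g y - (\<phi> y / overlap) *\<^sub>R (\<integral>z. \<psi> z *\<^sub>R g z \<partial>\<mu>))"
      proof -
        have "exp (lam * t\<^sub>1) *\<^sub>R ((\<phi> y / overlap) *\<^sub>R (\<integral>z. \<psi> z *\<^sub>R g z \<partial>\<mu>))
            = (exp (lam * t\<^sub>1) * exp (- lam * t\<^sub>1) * (\<phi> y / overlap)) *\<^sub>R (\<integral>z. \<psi> z *\<^sub>R f z \<partial>\<mu>)"
          unfolding \<psi>g by (simp add: ac_simps)
        moreover have "exp (lam * \<tau>) *\<^sub>R kernel_op \<mu> (u \<tau>) f y = exp (lam * t\<^sub>1) *\<^sub>R (exp (lam * r) *\<^sub>R kernel_op \<mu> (u r) g y)"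
          using elim(1) by (simp add: r(3) distrib_left exp_add mult.commute)
        ultimately show ?thesis
          unfolding e by (simp add: scaleR_diff_right)
      qed
      also have "cmod \<dots> \<le> exp (lam * t\<^sub>1) * (C * exp (- \<gamma> * r) * K)"
        unfolding norm_scaleR using elim(2) g(2) C(1)
        by (auto intro!: mult_left_mono elim!: order_trans)
      also have "\<dots> \<le> exp (lam * t\<^sub>1) * (C * exp (- \<gamma> * r) * (K + 1))"
        using C(1) by (intro mult_left_mono) auto
      also have "\<dots> = C' * exp (- \<gamma> * \<tau>)"
        by (simp add: C'_def r(3) algebra_simps flip: exp_add)
      finally show ?case .
    qed
  qed
  moreover have "C' > 0"
    using C(1) K(1) by (simp add: C'_def)
  ultimately show ?thesis
    using that by blast
qed

text \<open>
  At late times the semigroup law and boundedness hold on every $L^p$, whence the continuous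
  versions of \<open>U\<^sub>t f\<close>.
\<close>

lemma kernel_op_add_late:
  fixes f :: "'a \<Rightarrow> complex"
  assumes f: "f \<in> Lp_unit_balls \<mu>" and s: "s > 0" and t: "t > 2 * t\<^sub>0"
  shows "AE x in \<mu>. kernel_op \<mu> (u (s + t)) f x = kernel_op \<mu> (u s) (kernel_op \<mu> (u t) f) x"
    and "kernel_op \<mu> (u t) f \<in> Lp \<mu> \<infinity>"
proof -
  interpret sigma_finite_measure \<mu> by (rule sigma_finite)
  have t': "t > 0" and st: "s + t > 2 * t\<^sub>0"
    using s t t0_pos by auto
  have [measurable]: "f \<in> borel_measurable \<mu>"
    using f by (rule Lp_unit_balls_measurable)
  note [measurable] = kernel_measurable'[OF t']
  obtain D where D: "D \<ge> 0" "\<And>f :: 'a \<Rightarrow> complex. f \<in> Lp_unit_balls \<mu> \<Longrightarrow>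
      AE x in \<mu>. integrable \<mu> (\<lambda>y. u t x y *\<^sub>R f y) \<and> (\<integral>y. norm (u t x y *\<^sub>R f y) \<partial>\<mu>) \<le> D"
    using Lp_Linfty_bound[OF t] by blast
  obtain D' where D': "\<And>f :: 'a \<Rightarrow> complex. f \<in> Lp_unit_balls \<mu> \<Longrightarrow>
      AE x in \<mu>. integrable \<mu> (\<lambda>y. u (s + t) x y *\<^sub>R f y) \<and> (\<integral>y. norm (u (s + t) x y *\<^sub>R f y) \<partial>\<mu>) \<le> D'"
    using Lp_Linfty_bound[OF st] by blast
  show "AE x in \<mu>. kernel_op \<mu> (u (s + t)) f x = kernel_op \<mu> (u s) (kernel_op \<mu> (u t) f) x"
  proof (rule kernel_op_add[OF s t'])
    let ?G = "\<lambda>z. \<integral>y. norm (u t z y *\<^sub>R f y) \<partial>\<mu>"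
    have "?G \<in> borel_measurable \<mu>"
      by (rule borel_measurable_lebesgue_integral) (simp add: split_beta')
    moreover have "AE z in \<mu>. norm (?G z) \<le> D"
      using D(2)[OF f] by eventually_elim (simp del: norm_scaleR)
    ultimately have "AE x in \<mu>. integrable \<mu> (\<lambda>z. u s x z *\<^sub>R ?G z) \<and> norm (kernel_op \<mu> (u s) ?G x) \<le> D * mass s x"
      by (rule kernel_op_bounded[OF s])
    then show "AE x in \<mu>. integrable \<mu> (\<lambda>z. u s x z * ?G z)"
      by (auto elim!: eventually_mono)
  qed (use D(2)[OF f] D'[OF f] in \<open>auto elim!: eventually_mono\<close>)
  have "AE x in \<mu>. norm (kernel_op \<mu> (u t) f x) \<le> D"
    using D(2)[OF f]
    by eventually_elim (unfold kernel_op_def, blast intro: order_trans[OF integral_norm_bound])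
  then show "kernel_op \<mu> (u t) f \<in> Lp \<mu> \<infinity>"
    unfolding Lp_infinity_iff using D(1) kernel_op_measurable[OF t', of f] by auto
qed

lemma continuous_version_Lp:
  fixes f :: "'a \<Rightarrow> complex"
  assumes f: "f \<in> Lp_unit_balls \<mu>" and t: "t > 2 * t\<^sub>0"
  shows "continuous_on UNIV (sg_cont \<mu> u t f)"
    and "bounded (range (sg_cont \<mu> u t f))"
    and "AE x in \<mu>. sg_cont \<mu> u t f x = kernel_op \<mu> (u t) f x"
proof -
  \<comment> \<open>Any \<open>s > 0\<close> with \<open>t - s > 2 t\<^sub>0\<close> will do: \<open>U\<^bsub>t-s\<^esub> f\<close> is bounded, and \<open>U\<^sub>s\<close> makes it continuous.\<close>
  define s where "s = (t - 2 * t\<^sub>0) / 2"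
  have s: "s > 0" "t - s > 2 * t\<^sub>0" "t \<noteq> 0"
    using t t0_pos by (auto simp: s_def field_simps)
  have "AE x in \<mu>. kernel_op \<mu> (u t) f x = kernel_op \<mu> (u s) (kernel_op \<mu> (u (t - s)) f) x"
    using kernel_op_add_late(1)[OF f s(1,2)] by simp
  moreover obtain h where h: "continuous_on UNIV h" "bounded (range h)"
    "AE x in \<mu>. h x = kernel_op \<mu> (u s) (kernel_op \<mu> (u (t - s)) f) x"
    using continuous_version_complex[OF s(1) kernel_op_add_late(2)[OF f s(1,2)]] by blast
  ultimately have eq: "AE x in \<mu>. h x = kernel_op \<mu> (u t) f x"
    by (auto elim: eventually_elim2)
  then have "sg_cont \<mu> u t f = h"
    unfolding sg_cont_def using h(1) s(3) by (intro cont_version) (auto simp: sg_def)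
  then show "continuous_on UNIV (sg_cont \<mu> u t f)"
    "bounded (range (sg_cont \<mu> u t f))"
    "AE x in \<mu>. sg_cont \<mu> u t f x = kernel_op \<mu> (u t) f x"
    using h eq by auto
qed

text \<open>
  The initial factor \<open>U\<^sub>s\<close> in \<open>U\<^sub>t = U\<^sub>s U\<^bsub>t-s\<^esub>\<close> turns the uniform error into a multiple of \<open>U\<^sub>s 1\<close>; being an
  inequality between continuous functions, it then holds at every point.
\<close>

lemma pointwise_rate:
  obtains C where "C > 0"
    "\<And>f :: 'a \<Rightarrow> complex. \<And>t s x. f \<in> Lp_unit_balls \<mu> \<Longrightarrow> t > 6 * t\<^sub>1 \<Longrightarrow> t\<^sub>1 \<le> s \<Longrightarrow> s \<le> t / 2 \<Longrightarrow>
      cmod (exp (lam * t) *\<^sub>R sg_cont \<mu> u t f x - (\<phi> x / overlap) *\<^sub>R (\<integral>z. \<psi> z *\<^sub>R f z \<partial>\<mu>))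
        \<le> C * exp (- \<gamma> * (t - s)) * (exp (lam * s) * sg_cont \<mu> u s (\<lambda>_. 1 :: real) x)"
proof -
  obtain C where C: "C > 0"
    "\<And>f :: 'a \<Rightarrow> complex. \<And>\<tau>. f \<in> Lp_unit_balls \<mu> \<Longrightarrow> \<tau> > t\<^sub>1 + 2 * t\<^sub>0 \<Longrightarrow>
      AE y in \<mu>. cmod (exp (lam * \<tau>) *\<^sub>R kernel_op \<mu> (u \<tau>) f y - (\<phi> y / overlap) *\<^sub>R (\<integral>z. \<psi> z *\<^sub>R f z \<partial>\<mu>))
        \<le> C * exp (- \<gamma> * \<tau>)"
    using Lp_Linfty_rate by blast
  have "cmod (exp (lam * t) *\<^sub>R sg_cont \<mu> u t f x - (\<phi> x / overlap) *\<^sub>R (\<integral>z. \<psi> z *\<^sub>R f z \<partial>\<mu>))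
        \<le> C * exp (- \<gamma> * (t - s)) * (exp (lam * s) * sg_cont \<mu> u s (\<lambda>_. 1 :: real) x)"
    if f: "f \<in> Lp_unit_balls \<mu>" and ts: "t > 6 * t\<^sub>1" "t\<^sub>1 \<le> s" "s \<le> t / 2"
    for f :: "'a \<Rightarrow> complex" and t s x
  proof -
    define \<tau> where "\<tau> = t - s"
    have \<tau>: "\<tau> > t\<^sub>1 + 2 * t\<^sub>0" "\<tau> > 2 * t\<^sub>0" "s > 0" "t = s + \<tau>" "t > 2 * t\<^sub>0" "\<tau> > 0"
      using ts t1_pos t0_pos t0_le_t1 by (auto simp: \<tau>_def)
    have [measurable]: "f \<in> borel_measurable \<mu>"
      using f by (rule Lp_unit_balls_measurable)
    define q where "q = (\<integral>z. \<psi> z *\<^sub>R f z \<partial>\<mu>)"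
    define d where "d y = exp (lam * \<tau>) *\<^sub>R kernel_op \<mu> (u \<tau>) f y - (\<phi> y / overlap) *\<^sub>R q" for y
    have d_meas: "d \<in> borel_measurable \<mu>"
      unfolding d_def using kernel_op_measurable[OF \<tau>(6), of f] by measurable
    have d: "AE x in \<mu>. integrable \<mu> (\<lambda>y. u s x y *\<^sub>R d y) \<and>
        cmod (kernel_op \<mu> (u s) d x) \<le> C * exp (- \<gamma> * \<tau>) * mass s x"
      using C(2)[OF f \<tau>(1)] by (intro kernel_op_bounded[OF \<tau>(3) d_meas]) (simp add: d_def q_def)
    obtain b where b: "b > 0" "\<And>x. \<phi> x \<le> b" using \<phi>_bound by blast
    have \<phi>_int: "AE x in \<mu>. integrable \<mu> (\<lambda>y. u s x y *\<^sub>R \<phi> y) \<and> norm (kernel_op \<mu> (u s) \<phi> x) \<le> b * mass s x"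
      using b \<phi>_nonneg by (intro kernel_op_bounded \<tau>) auto
    have "AE x in \<mu>. cmod (exp (lam * t) *\<^sub>R sg_cont \<mu> u t f x - (\<phi> x / overlap) *\<^sub>R q)
        \<le> C * exp (- \<gamma> * \<tau>) * (exp (lam * s) * sg_cont \<mu> u s (\<lambda>_. 1 :: real) x)"
      using d \<phi>_int kernel_op_add_late(1)[OF f \<tau>(3,2)] eigenfunction[OF \<tau>(3)]
        continuous_version_Lp(3)[OF f \<tau>(5)] continuous_mass(3)[OF \<tau>(3)]
    proof eventually_elim
      case (elim x)
      have split: "u s x y *\<^sub>R d y
          = exp (lam * \<tau>) *\<^sub>R (u s x y *\<^sub>R kernel_op \<mu> (u \<tau>) f y) - ((u s x y *\<^sub>R \<phi> y) *\<^sub>R ((1 / overlap) *\<^sub>R q))" for y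
        by (simp add: d_def scaleR_diff_right mult.commute)
      have int2: "integrable \<mu> (\<lambda>y. (u s x y *\<^sub>R \<phi> y) *\<^sub>R ((1 / overlap) *\<^sub>R q))"
        using elim(2) by (intro integrable_scaleR_left) auto
      have eq1: "exp (lam * \<tau>) *\<^sub>R (u s x y *\<^sub>R kernel_op \<mu> (u \<tau>) f y)
          = u s x y *\<^sub>R d y + (u s x y *\<^sub>R \<phi> y) *\<^sub>R ((1 / overlap) *\<^sub>R q)" for y
        by (simp add: split)
      have "exp (lam * \<tau>) *\<^sub>R kernel_op \<mu> (u t) f x
          = (\<integral>y. exp (lam * \<tau>) *\<^sub>R (u s x y *\<^sub>R kernel_op \<mu> (u \<tau>) f y) \<partial>\<mu>)"
        using elim(3) by (simp add: \<tau>(4) kernel_op_def[of _ "u s"] del: scaleR_scaleR)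
      also have "\<dots> = kernel_op \<mu> (u s) d x + kernel_op \<mu> (u s) \<phi> x *\<^sub>R ((1 / overlap) *\<^sub>R q)"
        unfolding eq1 kernel_op_def[of _ _ d] kernel_op_def[of _ _ \<phi>]
        using elim(1,2) int2
        by (subst Bochner_Integration.integral_add) (auto simp del: scaleR_scaleR real_scaleR_def)
      finally have *: "exp (lam * \<tau>) *\<^sub>R kernel_op \<mu> (u t) f x
        = kernel_op \<mu> (u s) d x + (exp (- lam * s) * \<phi> x / overlap) *\<^sub>R q"
        using elim(4) by simp
      have "exp (lam * t) *\<^sub>R sg_cont \<mu> u t f x - (\<phi> x / overlap) *\<^sub>R q
          = exp (lam * s) *\<^sub>R (exp (lam * \<tau>) *\<^sub>R kernel_op \<mu> (u t) f x) - (\<phi> x / overlap) *\<^sub>R q"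
        using elim(5) by (simp add: \<tau>(4) distrib_left exp_add)
      also have "\<dots> = exp (lam * s) *\<^sub>R kernel_op \<mu> (u s) d x"
        unfolding * by (simp add: scaleR_add_right exp_minus field_simps)
      also have "cmod \<dots> \<le> exp (lam * s) * (C * exp (- \<gamma> * \<tau>) * mass s x)"
        unfolding norm_scaleR using elim(1) by (auto intro!: mult_left_mono)
      finally show ?case
        using elim(6) by (simp add: ac_simps)
    qed
    then show ?thesis
      unfolding q_def[symmetric] \<tau>_def[symmetric]
    proof (rule AE_imp_everywhere[rotated])
      show "closed {x. cmod (exp (lam * t) *\<^sub>R sg_cont \<mu> u t f x - (\<phi> x / overlap) *\<^sub>R q)
        \<le> C * exp (- \<gamma> * \<tau>) * (exp (lam * s) * sg_cont \<mu> u s (\<lambda>_. 1 :: real) x)}"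
        using continuous_version_Lp(1)[OF f \<tau>(5)] continuous_mass(1)[OF \<tau>(3)] \<phi>_cont overlap_pos
        by (intro closed_Collect_le continuous_intros) auto
    qed
  qed
  with C(1) show ?thesis
    using that by blast
qed

text \<open>Apply the positive operator \<open>U\<^sub>t\<close> to \<open>\<phi> \<le> b\<close>.\<close>

lemma \<phi>_le_mass:
  assumes t: "t > 0" and b: "b > 0" "\<And>x. \<phi> x \<le> b"
  shows "\<phi> x \<le> b * (exp (lam * t) * sg_cont \<mu> u t (\<lambda>_. 1 :: real) x)"
proof (rule AE_imp_everywhere[where P = "\<lambda>x. \<phi> x \<le> b * (exp (lam * t) * sg_cont \<mu> u t (\<lambda>_. 1 :: real) x)"])
  show "closed {x. \<phi> x \<le> b * (exp (lam * t) * sg_cont \<mu> u t (\<lambda>_. 1 :: real) x)}"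
    using continuous_mass(1)[OF t] \<phi>_cont by (intro closed_Collect_le continuous_intros)
  have "AE x in \<mu>. integrable \<mu> (\<lambda>y. u t x y *\<^sub>R \<phi> y) \<and> norm (kernel_op \<mu> (u t) \<phi> x) \<le> b * mass t x"
    using b \<phi>_nonneg by (intro kernel_op_bounded t) auto
  then show "AE x in \<mu>. \<phi> x \<le> b * (exp (lam * t) * sg_cont \<mu> u t (\<lambda>_. 1 :: real) x)"
    using eigenfunction[OF t] continuous_mass(3)[OF t]
  proof eventually_elim
    case (elim x)
    have "\<phi> x = exp (lam * t) * kernel_op \<mu> (u t) \<phi> x"
      using elim(2) by (simp add: exp_minus field_simps)
    also have "\<dots> \<le> exp (lam * t) * (b * mass t x)"
      using elim(1) by (intro mult_left_mono) auto
    finally show ?case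
      using elim(3) by (simp add: ac_simps)
  qed
qed

end

section \<open>Ergodicity and quasi-stationary measures\<close>

text \<open>
  If \<open>e a\<close> and \<open>e b\<close> are both within \<open>E\<close> of multiples of \<open>S\<close> whose ratio is \<open>q\<close>, then
  \<open>e b (a/b - q)\<close> is the difference of the two errors, the second one times \<open>q\<close>; the lower bound \<open>S/B\<close> for
  \<open>e b\<close> then turns this into a bound for \<open>a/b - q\<close>.
\<close>

lemma quotient_deviation_le:
  fixes a q z :: complex and e b S E B :: real
  assumes S: "S > 0" and B: "B > 0" and S_le: "S \<le> B * (e * b)"
    and a: "cmod (e *\<^sub>R a - S *\<^sub>R (k *\<^sub>R z)) \<le> E"
    and b: "\<bar>e * b - S * (k * l)\<bar> \<le> E"
    and q: "z = l *\<^sub>R q" and Q: "cmod q \<le> Q"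
  shows "cmod (a / complex_of_real b - q) \<le> E * (1 + Q) * B / S"
proof -
  have eb: "e * b > 0"
    using S S_le B by (metis order_less_le_trans zero_less_mult_pos)
  then have b0: "b \<noteq> 0" and e0: "e \<noteq> 0"
    by auto
  have E: "0 \<le> E"
    using b by linarith
  have "(e * b) *\<^sub>R (a / complex_of_real b - q) = e *\<^sub>R a - (e * b) *\<^sub>R q"
    using b0 by (simp add: scaleR_conv_of_real right_diff_distrib)
  also have "\<dots> = (e *\<^sub>R a - S *\<^sub>R (k *\<^sub>R z)) - (e * b - S * (k * l)) *\<^sub>R q"
    unfolding q by (simp add: algebra_simps)
  finally have "(e * b) * cmod (a / complex_of_real b - q)
      = cmod ((e *\<^sub>R a - S *\<^sub>R (k *\<^sub>R z)) - (e * b - S * (k * l)) *\<^sub>R q)"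
    using eb by (metis abs_of_pos norm_scaleR)
  also have "\<dots> \<le> cmod (e *\<^sub>R a - S *\<^sub>R (k *\<^sub>R z)) + \<bar>e * b - S * (k * l)\<bar> * cmod q"
    by (rule order_trans[OF norm_triangle_ineq4]) simp
  also have "\<dots> \<le> E + E * Q"
    using a b Q E by (intro add_mono mult_mono) auto
  finally have "(e * b) * cmod (a / complex_of_real b - q) \<le> E * (1 + Q)"
    by (simp add: distrib_left)
  then have "cmod (a / complex_of_real b - q) \<le> E * (1 + Q) / (e * b)"
    using eb by (simp add: pos_le_divide_eq mult.commute)
  also have "\<dots> \<le> E * (1 + Q) / (S / B)"
  proof (rule divide_left_mono)
    show "S / B \<le> e * b"
      using S_le B by (simp add: pos_divide_le_eq mult.commute)
    show "0 \<le> E * (1 + Q)"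
      using E order_trans[OF norm_ge_zero Q] by simp
  qed (use S B eb in simp)
  finally show ?thesis
    by simp
qed

text \<open>
  The complement of the support is a union of open null sets, of which countably many suffice.
\<close>

lemma measure_support_meets:
  fixes \<sigma> :: "'a::second_countable_topology measure"
  assumes sets: "sets \<sigma> = sets borel" and S: "S \<in> sets borel" and pos: "emeasure \<sigma> S \<noteq> 0"
  shows "measure_support \<sigma> \<inter> S \<noteq> {}"
proof
  assume empty: "measure_support \<sigma> \<inter> S = {}"
  define \<F> where "\<F> = {U. open U \<and> emeasure \<sigma> U = 0}"
  obtain F where F: "F \<subseteq> \<F>" "countable F" "\<Union>F = \<Union>\<F>"
    using Lindelof[of \<F>] by (auto simp: \<F>_def)
  have "S \<subseteq> \<Union>\<F>"
  proof
    fix x assume "x \<in> S"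
    then have "x \<notin> measure_support \<sigma>"
      using empty by blast
    then obtain U where "open U" "x \<in> U" "\<not> 0 < emeasure \<sigma> U"
      unfolding measure_support_def by blast
    then show "x \<in> \<Union>\<F>"
      by (auto simp: \<F>_def zero_less_iff_neq_zero)
  qed
  have "(\<Union>U\<in>F. U) \<in> null_sets \<sigma>"
    using F(1,2) by (intro null_sets_UN') (auto simp: \<F>_def sets null_sets_def)
  then have "S \<in> null_sets \<sigma>"
    by (rule null_sets_subset) (use S sets \<open>S \<subseteq> \<Union>\<F>\<close> F(3) in auto)
  then show False
    using pos by auto
qed

lemma finite_measure_integrable_bounded_continuous:
  fixes f :: "'a::topological_space \<Rightarrow> 'b::{banach, second_countable_topology}"
  assumes "finite_measure \<sigma>" "sets \<sigma> = sets borel" "continuous_on UNIV f" "bounded (range f)"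
  shows "integrable \<sigma> f"
proof -
  obtain B where "\<And>x. norm (f x) \<le> B"
    using assms(4) by (auto simp: bounded_iff)
  moreover have "f \<in> borel_measurable \<sigma>"
    using borel_measurable_continuous_onI[OF assms(3)] measurable_cong_sets[OF assms(2) refl] by blast
  ultimately show ?thesis
    using assms(1) by (intro finite_measure.integrable_const_bound[of _ _ B]) auto
qed

context finite_heat_kernel
begin

text \<open>
  The denominator of the quotient is formed with the real constant \<open>1\<close>, the estimates with complex
  functions.
\<close>

lemma sg_cont_complex_one:
  assumes t: "t > 0"
  shows "sg_cont \<mu> u t (\<lambda>_. 1 :: complex) = (\<lambda>x. complex_of_real (sg_cont \<mu> u t (\<lambda>_. 1) x))"
  unfolding sg_cont_def[of _ _ _ "\<lambda>_. 1 :: complex"]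
proof (rule cont_version)
  show "continuous_on UNIV (\<lambda>x. complex_of_real (sg_cont \<mu> u t (\<lambda>_. 1) x))"
    using continuous_mass(1)[OF t] by (intro continuous_intros)
  show "AE x in \<mu>. complex_of_real (sg_cont \<mu> u t (\<lambda>_. 1) x) = sg \<mu> u t (\<lambda>_. 1) x"
    using continuous_mass(3)[OF t]
  proof eventually_elim
    case (elim x)
    then show ?case
      using t kernel_op_of_real[of "u t" "\<lambda>_. 1" x] by (simp add: sg_def mass_eq)
  qed
qed

lemma mass_cont_nonneg:
  assumes t: "t > 0"
  shows "0 \<le> sg_cont \<mu> u t (\<lambda>_. 1 :: real) x"
proof (rule AE_imp_everywhere[where P = "\<lambda>x. 0 \<le> sg_cont \<mu> u t (\<lambda>_. 1 :: real) x"])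
  show "closed {x. 0 \<le> sg_cont \<mu> u t (\<lambda>_. 1 :: real) x}"
    using continuous_mass(1)[OF t] by (intro closed_Collect_le continuous_on_const)
  show "AE x in \<mu>. 0 \<le> sg_cont \<mu> u t (\<lambda>_. 1 :: real) x"
    using continuous_mass(3)[OF t] mass_nonneg[OF t] by eventually_elim simp
qed

lemma prob_space_normalized: "prob_space (normalized_measure \<mu> \<psi>)"
proof
  let ?I = "\<integral>x. \<psi> x \<partial>\<mu>"
  have "(\<integral>\<^sup>+x. ennreal (\<psi> x / ?I) \<partial>\<mu>) = ennreal (\<integral>x. \<psi> x / ?I \<partial>\<mu>)"
    using \<psi>_integrable \<psi>_nonneg integral_\<psi>_pos by (intro nn_integral_eq_integral) auto
  also have "\<dots> = 1"
    using integral_\<psi>_pos by simp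
  finally show "emeasure (normalized_measure \<mu> \<psi>) (space (normalized_measure \<mu> \<psi>)) = 1"
    using emeasure_density[of "\<lambda>x. ennreal (\<psi> x / ?I)" \<mu> UNIV]
    by (simp add: normalized_measure_def sets_eq)
qed

lemma sets_normalized: "sets (normalized_measure \<mu> \<psi>) = sets borel"
  by (simp add: normalized_measure_def sets_eq)

lemma integral_normalized:
  fixes f :: "'a \<Rightarrow> 'b::{banach, second_countable_topology}"
  assumes [measurable]: "f \<in> borel_measurable \<mu>"
  shows "(\<integral>x. \<psi> x *\<^sub>R f x \<partial>\<mu>) = (\<integral>x. \<psi> x \<partial>\<mu>) *\<^sub>R (\<integral>x. f x \<partial>(normalized_measure \<mu> \<psi>))"
proof -
  let ?I = "\<integral>x. \<psi> x \<partial>\<mu>"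
  have "(\<integral>x. f x \<partial>(normalized_measure \<mu> \<psi>)) = (\<integral>x. (\<psi> x / ?I) *\<^sub>R f x \<partial>\<mu>)"
    unfolding normalized_measure_def using integral_\<psi>_pos \<psi>_nonneg
    by (intro integral_density) auto
  also have "\<dots> = (\<integral>x. (1 / ?I) *\<^sub>R (\<psi> x *\<^sub>R f x) \<partial>\<mu>)"
    by simp
  also have "\<dots> = (1 / ?I) *\<^sub>R (\<integral>x. \<psi> x *\<^sub>R f x \<partial>\<mu>)"
    by (rule integral_scaleR_right)
  finally show ?thesis
    using integral_\<psi>_pos by simp
qed

text \<open>
  \<open>\<sigma>\<close> may be singular to \<open>\<mu>\<close>, so that \<open>\<phi> > 0\<close> almost everywhere gives nothing; what counts is that \<open>\<phi>\<close> is
  positive near a point of the support.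
\<close>

lemma ground_state_integral_pos:
  assumes sets: "sets \<sigma> = sets borel" and fin: "finite_measure \<sigma>"
    and meets: "measure_support \<sigma> \<inter> - nodal_set \<phi> \<psi> \<noteq> {}"
  shows "0 < (\<integral>x. \<phi> x \<partial>\<sigma>)"
proof -
  obtain x where x: "x \<in> measure_support \<sigma>" "\<phi> x \<noteq> 0"
    using meets by (auto simp: nodal_set_def)
  have "open {x. \<phi> x \<noteq> 0}"
    using \<phi>_cont by (intro open_Collect_neq continuous_on_const)
  then have pos: "0 < emeasure \<sigma> {x. \<phi> x \<noteq> 0}"
    using x by (auto simp: measure_support_def)
  have int: "integrable \<sigma> \<phi>"
    using fin sets \<phi>_cont \<phi>_bounded by (rule finite_measure_integrable_bounded_continuous)
  have "(\<integral>x. \<phi> x \<partial>\<sigma>) \<noteq> 0"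
  proof
    assume "(\<integral>x. \<phi> x \<partial>\<sigma>) = 0"
    then have "AE x in \<sigma>. \<phi> x = 0"
      using int \<phi>_nonneg by (subst (asm) integral_nonneg_eq_0_iff_AE) auto
    then have "emeasure \<sigma> {x. \<phi> x \<noteq> 0} = 0"
      using \<open>open {x. \<phi> x \<noteq> 0}\<close> sets sets_eq_imp_space_eq[OF sets]
      by (subst (asm) AE_iff_measurable[OF _ refl]) auto
    with pos show False
      by simp
  qed
  moreover have "0 \<le> (\<integral>x. \<phi> x \<partial>\<sigma>)"
    using \<phi>_nonneg by (intro integral_nonneg_AE) auto
  ultimately show ?thesis
    by simp
qed

text \<open>
  Integrating the pointwise estimate against \<open>\<sigma>\<close> compares the numerator and, with \<open>f = 1\<close>, the
  denominator with multiples of \<open>\<sigma>(\<phi>)\<close>. The quotient is controlled because \<open>\<phi> \<le> b\<close> forces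
  \<open>\<sigma>(\<phi>) \<le> b e\<^bsup>\<lambda>t\<^esup> \<sigma>(U\<^sub>t 1)\<close>.
\<close>

lemma ergodic_deviation_bound:
  obtains C where "C > 0"
    "\<And>p \<sigma> t s. 1 \<le> p \<Longrightarrow> sets \<sigma> = sets borel \<Longrightarrow> finite_measure \<sigma> \<Longrightarrow>
      measure_support \<sigma> \<inter> - nodal_set \<phi> \<psi> \<noteq> {} \<Longrightarrow> t > 6 * t\<^sub>1 \<Longrightarrow> t\<^sub>1 \<le> s \<Longrightarrow> s \<le> t / 2 \<Longrightarrow>
      ergodic_deviation \<mu> u p \<sigma> t (normalized_measure \<mu> \<psi>)
        \<le> ereal (C * exp (- \<gamma> * (t - s))
            * (exp (lam * s) * (\<integral>x. sg_cont \<mu> u s (\<lambda>_. 1) x \<partial>\<sigma>) / (\<integral>x. \<phi> x \<partial>\<sigma>)))"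
proof -
  obtain C where C: "C > 0"
    "\<And>f :: 'a \<Rightarrow> complex. \<And>t s x. f \<in> Lp_unit_balls \<mu> \<Longrightarrow> t > 6 * t\<^sub>1 \<Longrightarrow> t\<^sub>1 \<le> s \<Longrightarrow> s \<le> t / 2 \<Longrightarrow>
      cmod (exp (lam * t) *\<^sub>R sg_cont \<mu> u t f x - (\<phi> x / overlap) *\<^sub>R (\<integral>z. \<psi> z *\<^sub>R f z \<partial>\<mu>))
        \<le> C * exp (- \<gamma> * (t - s)) * (exp (lam * s) * sg_cont \<mu> u s (\<lambda>_. 1 :: real) x)"
    using pointwise_rate by blast
  obtain w where w: "w \<ge> 0" "\<And>f :: 'a \<Rightarrow> complex. f \<in> Lp_unit_balls \<mu> \<Longrightarrow>
      integrable \<mu> (\<lambda>x. \<psi> x *\<^sub>R f x) \<and> norm (\<integral>x. \<psi> x *\<^sub>R f x \<partial>\<mu>) \<le> w"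
    using \<psi>_weight by blast
  obtain B where B: "B > 0" "\<And>x. \<phi> x \<le> B" using \<phi>_bound by blast
  define I where "I = (\<integral>x. \<psi> x \<partial>\<mu>)"
  have I: "I > 0"
    unfolding I_def by (rule integral_\<psi>_pos)
  define Q where "Q = w / I"
  define C' where "C' = C * (1 + Q) * B"
  have "ergodic_deviation \<mu> u p \<sigma> t (normalized_measure \<mu> \<psi>)
        \<le> ereal (C' * exp (- \<gamma> * (t - s))
            * (exp (lam * s) * (\<integral>x. sg_cont \<mu> u s (\<lambda>_. 1) x \<partial>\<sigma>) / (\<integral>x. \<phi> x \<partial>\<sigma>)))"
    if p: "1 \<le> p" and \<sigma>: "sets \<sigma> = sets borel" "finite_measure \<sigma>"
      and meets: "measure_support \<sigma> \<inter> - nodal_set \<phi> \<psi> \<noteq> {}"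
      and ts: "t > 6 * t\<^sub>1" "t\<^sub>1 \<le> s" "s \<le> t / 2" for p \<sigma> t s
  proof -
    have t: "t > 2 * t\<^sub>0" "t > 0" "s > 0"
      using ts t0_pos t1_pos t0_le_t1 by auto
    define S where "S = (\<integral>x. \<phi> x \<partial>\<sigma>)"
    have S: "S > 0"
      unfolding S_def by (rule ground_state_integral_pos[OF \<sigma> meets])
    define e where "e = exp (lam * t)"
    define E where "E = C * exp (- \<gamma> * (t - s)) * (exp (lam * s) * (\<integral>x. sg_cont \<mu> u s (\<lambda>_. 1) x \<partial>\<sigma>))"
    let ?M = "\<integral>x. sg_cont \<mu> u t (\<lambda>_. 1 :: real) x \<partial>\<sigma>"
    note int_cb = finite_measure_integrable_bounded_continuous[OF \<sigma>(2,1)]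
    have \<phi>_int: "integrable \<sigma> \<phi>"
      by (rule int_cb[OF \<phi>_cont \<phi>_bounded])
    have M_int: "integrable \<sigma> (sg_cont \<mu> u t (\<lambda>_. 1 :: real))"
      using continuous_mass(1,2)[OF t(2)] by (rule int_cb)
    have Ms_int: "integrable \<sigma> (sg_cont \<mu> u s (\<lambda>_. 1 :: real))"
      using continuous_mass(1,2)[OF t(3)] by (rule int_cb)
    have dev: "cmod (e *\<^sub>R (\<integral>x. sg_cont \<mu> u t f x \<partial>\<sigma>) - S *\<^sub>R ((1 / overlap) *\<^sub>R (\<integral>z. \<psi> z *\<^sub>R f z \<partial>\<mu>))) \<le> E"
      if f: "f \<in> Lp_unit_balls \<mu>" for f :: "'a \<Rightarrow> complex"
    proof -
      define q where "q = (\<integral>z. \<psi> z *\<^sub>R f z \<partial>\<mu>)"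
      have F_int: "integrable \<sigma> (sg_cont \<mu> u t f)"
        using continuous_version_Lp(1,2)[OF f t(1)] by (rule int_cb)
      have int: "integrable \<sigma> (\<lambda>x. e *\<^sub>R sg_cont \<mu> u t f x)" "integrable \<sigma> (\<lambda>x. (\<phi> x / overlap) *\<^sub>R q)"
        using F_int \<phi>_int by (auto intro!: integrable_scaleR_right integrable_scaleR_left integrable_divide)
      have "e *\<^sub>R (\<integral>x. sg_cont \<mu> u t f x \<partial>\<sigma>) - S *\<^sub>R ((1 / overlap) *\<^sub>R q)
          = (\<integral>x. e *\<^sub>R sg_cont \<mu> u t f x - (\<phi> x / overlap) *\<^sub>R q \<partial>\<sigma>)"
        using int \<phi>_int by (simp add: S_def)
      also have "cmod \<dots> \<le> (\<integral>x. cmod (e *\<^sub>R sg_cont \<mu> u t f x - (\<phi> x / overlap) *\<^sub>R q) \<partial>\<sigma>)"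
        by (rule integral_norm_bound)
      also have "\<dots> \<le> (\<integral>x. C * exp (- \<gamma> * (t - s)) * (exp (lam * s) * sg_cont \<mu> u s (\<lambda>_. 1 :: real) x) \<partial>\<sigma>)"
        using int Ms_int C(2)[OF f ts] unfolding e_def q_def
        by (intro integral_mono integrable_norm Bochner_Integration.integrable_diff integrable_mult_right) auto
      also have "\<dots> = E"
        by (simp add: E_def)
      finally show ?thesis
        unfolding q_def .
    qed
    have one: "(\<lambda>_. 1 :: complex) \<in> Lp_unit_balls \<mu>"
      by (rule bounded_in_Lp_unit_balls) auto
    have dev_one: "\<bar>e * ?M - S * ((1 / overlap) * I)\<bar> \<le> E"
    proof -
      have "(\<integral>z. \<psi> z *\<^sub>R (1 :: complex) \<partial>\<mu>) = complex_of_real I"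
        unfolding I_def by (simp add: scaleR_conv_of_real)
      then have "e *\<^sub>R (\<integral>x. sg_cont \<mu> u t (\<lambda>_. 1 :: complex) x \<partial>\<sigma>) - S *\<^sub>R ((1 / overlap) *\<^sub>R (\<integral>z. \<psi> z *\<^sub>R (1 :: complex) \<partial>\<mu>))
          = complex_of_real (e * ?M - S * ((1 / overlap) * I))"
        by (simp add: sg_cont_complex_one[OF t(2)] scaleR_conv_of_real)
      then show ?thesis
        using dev[OF one] by (metis norm_of_real)
    qed
    have S_le: "S \<le> B * (e * ?M)"
    proof -
      have "S \<le> (\<integral>x. B * (e * sg_cont \<mu> u t (\<lambda>_. 1 :: real) x) \<partial>\<sigma>)"
        unfolding S_def e_def using \<phi>_le_mass[OF t(2) B] \<phi>_int M_int
        by (intro integral_mono integrable_mult_right) auto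
      then show ?thesis
        by simp
    qed
    show ?thesis
      unfolding ergodic_deviation_def
    proof (rule SUP_least)
      fix f :: "'a \<Rightarrow> complex" assume "f \<in> {f. f \<in> Lp \<mu> p \<and> Lp_norm \<mu> p f \<le> 1}"
      then have f: "f \<in> Lp_unit_balls \<mu>"
        using p by (auto simp: Lp_unit_balls_def)
      let ?q = "\<integral>x. f x \<partial>(normalized_measure \<mu> \<psi>)"
      have q: "(\<integral>z. \<psi> z *\<^sub>R f z \<partial>\<mu>) = I *\<^sub>R ?q"
        unfolding I_def by (rule integral_normalized[OF Lp_unit_balls_measurable[OF f]])
      have "I * cmod ?q \<le> w"
        using w(2)[OF f] I unfolding q by simp
      then have Q: "cmod ?q \<le> Q"
        using I by (simp add: Q_def pos_le_divide_eq mult.commute)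
      have "cmod ((\<integral>x. sg_cont \<mu> u t f x \<partial>\<sigma>) / complex_of_real ?M - ?q) \<le> E * (1 + Q) * B / S"
        by (rule quotient_deviation_le[OF S B(1) S_le dev[OF f] dev_one q Q])
      also have "\<dots> = C' * exp (- \<gamma> * (t - s))
          * (exp (lam * s) * (\<integral>x. sg_cont \<mu> u s (\<lambda>_. 1) x \<partial>\<sigma>) / (\<integral>x. \<phi> x \<partial>\<sigma>))"
        by (simp add: C'_def E_def S_def)
      finally show "ereal (cmod ((\<integral>x. sg_cont \<mu> u t f x \<partial>\<sigma>) / complex_of_real ?M - ?q))
          \<le> ereal (C' * exp (- \<gamma> * (t - s))
            * (exp (lam * s) * (\<integral>x. sg_cont \<mu> u s (\<lambda>_. 1) x \<partial>\<sigma>) / (\<integral>x. \<phi> x \<partial>\<sigma>)))"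
        by simp
    qed
  qed
  moreover have "C' > 0"
    using C(1) B(1) w(1) I by (auto simp: C'_def Q_def intro!: mult_pos_pos add_pos_nonneg divide_nonneg_pos)
  ultimately show ?thesis
    using that by blast
qed

lemma quasi_stationary_normalized: "quasi_stationary \<mu> u (normalized_measure \<mu> \<psi>)"
  unfolding quasi_stationary_def
proof (intro conjI allI impI ballI)
  let ?m = "normalized_measure \<mu> \<psi>"
  let ?I = "\<integral>x. \<psi> x \<partial>\<mu>"
  show "sets ?m = sets borel" by (rule sets_normalized)
  show "prob_space ?m" by (rule prob_space_normalized)
  fix t :: real and f :: "'a \<Rightarrow> complex"
  assume t: "0 < t" and f: "f \<in> Lp \<mu> \<infinity>"
  have eq: "(\<integral>x. sg_cont \<mu> u t g x \<partial>?m) = exp (- lam * t) *\<^sub>R (\<integral>x. g x \<partial>?m)" if g: "g \<in> Lp \<mu> \<infinity>" for g :: "'a \<Rightarrow> complex"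
  proof -
    obtain B where gB: "g \<in> borel_measurable \<mu>" "AE x in \<mu>. norm (g x) \<le> B"
      using g unfolding Lp_infinity_iff by blast
    note gB(1)[measurable]
    obtain h where h: "continuous_on UNIV h" "bounded (range h)" "AE x in \<mu>. h x = kernel_op \<mu> (u t) g x"
      using continuous_version_complex[OF t g] by blast
    have sg: "sg_cont \<mu> u t g = h"
      unfolding sg_cont_def using h(1,3) t by (intro cont_version) (auto simp: sg_def)
    have h_meas[measurable]: "h \<in> borel_measurable \<mu>"
      using h(1) by (rule continuous_measurable)
    note [measurable] = kernel_op_measurable[OF t gB(1)]
    have \<psi>g: "integrable \<mu> (\<lambda>y. \<psi> y *\<^sub>R g y)"
    proof (rule Bochner_Integration.integrable_bound)
      show "integrable \<mu> (\<lambda>y. B * \<psi> y)"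
        using \<psi>_integrable by simp
      show "AE y in \<mu>. norm (\<psi> y *\<^sub>R g y) \<le> norm (B * \<psi> y)"
        using gB(2)
      proof eventually_elim
        case (elim y)
        then have "norm (g y) \<le> \<bar>B\<bar>"
          by linarith
        then show ?case
          using \<psi>_nonneg[of y] by (simp add: abs_mult mult.commute[of _ "\<psi> y"] mult_left_mono)
      qed
    qed measurable
    have "?I *\<^sub>R (\<integral>x. h x \<partial>?m) = (\<integral>x. \<psi> x *\<^sub>R h x \<partial>\<mu>)"
      by (rule integral_normalized[symmetric]) measurable
    also have "\<dots> = (\<integral>x. \<psi> x *\<^sub>R kernel_op \<mu> (u t) g x \<partial>\<mu>)"
      by (rule integral_cong_AE) (use h(3) in \<open>auto elim!: eventually_mono\<close>)
    also have "\<dots> = exp (- lam * t) *\<^sub>R (\<integral>x. \<psi> x *\<^sub>R g x \<partial>\<mu>)"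
      by (rule integral_\<psi>_kernel_op(2)[OF t gB(1) \<psi>g])
    also have "\<dots> = ?I *\<^sub>R (exp (- lam * t) *\<^sub>R (\<integral>x. g x \<partial>?m))"
      by (simp add: integral_normalized[OF gB(1)] mult.commute)
    finally show ?thesis
      unfolding sg using integral_\<psi>_pos by (simp del: scaleR_scaleR)
  qed
  have M: "(\<integral>x. sg_cont \<mu> u t (\<lambda>_. 1 :: real) x \<partial>?m) = exp (- lam * t)"
  proof -
    have "complex_of_real (\<integral>x. sg_cont \<mu> u t (\<lambda>_. 1 :: real) x \<partial>?m) = (\<integral>x. sg_cont \<mu> u t (\<lambda>_. 1 :: complex) x \<partial>?m)"
      by (simp add: sg_cont_complex_one[OF t])
    also have "\<dots> = exp (- lam * t) *\<^sub>R (\<integral>x. 1 \<partial>?m)"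
      by (rule eq[OF one_in_Lp_infinity])
    also have "(\<integral>x. 1 \<partial>?m) = (1 :: complex)"
      using prob_space.prob_space[OF prob_space_normalized] by simp
    finally show ?thesis
      by (metis of_real_eq_iff scaleR_conv_of_real mult.right_neutral)
  qed
  show "0 < (\<integral>x. sg_cont \<mu> u t (\<lambda>_. 1 :: real) x \<partial>?m)"
    by (simp add: M)
  show "(\<integral>x. sg_cont \<mu> u t f x \<partial>?m) / complex_of_real (\<integral>x. sg_cont \<mu> u t (\<lambda>_. 1) x \<partial>?m) = (\<integral>x. f x \<partial>?m)"
    unfolding M eq[OF f] by (simp add: scaleR_conv_of_real)
qed

lemma nodal_set_closed: "closed (nodal_set \<phi> \<psi>)"
proof -
  have "closed {x. \<phi> x = 0}" "closed {x. \<psi> x = 0}"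
    using \<phi>_cont \<psi>_cont by (auto intro!: closed_Collect_eq)
  then show ?thesis
    unfolding nodal_set_def by (rule closed_Un)
qed

lemma measure_normalized_off_nodal_set: "measure (normalized_measure \<mu> \<psi>) (- nodal_set \<phi> \<psi>) = 1"
proof -
  interpret prob_space "normalized_measure \<mu> \<psi>" by (rule prob_space_normalized)
  have "AE x in normalized_measure \<mu> \<psi>. x \<in> - nodal_set \<phi> \<psi>"
    unfolding normalized_measure_def using \<phi>_pos \<psi>_pos
    by (subst AE_density) (auto simp: nodal_set_def elim: eventually_elim2)
  moreover have "- nodal_set \<phi> \<psi> \<in> sets (normalized_measure \<mu> \<psi>)"
    using nodal_set_closed by (simp add: sets_normalized)
  ultimately show ?thesis
    by (simp add: prob_eq_1)
qed

text \<open>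
  For a quasi-stationary \<open>\<nu>\<close> the quotient in the ergodic estimate is \<open>\<nu>(f)\<close> for every \<open>t\<close>, so that
  \<open>t \<rightarrow> \<infinity>\<close> identifies it with the limit.
\<close>

lemma quasi_stationary_unique:
  assumes \<nu>: "quasi_stationary \<mu> u \<nu>" and pos: "measure \<nu> (- nodal_set \<phi> \<psi>) > 0"
  shows "\<nu> = normalized_measure \<mu> \<psi>"
proof -
  let ?m = "normalized_measure \<mu> \<psi>"
  have \<nu>_sets: "sets \<nu> = sets borel" and \<nu>_prob: "prob_space \<nu>"
    using \<nu> by (auto simp: quasi_stationary_def)
  interpret N: prob_space \<nu> by (rule \<nu>_prob)
  interpret m: prob_space ?m by (rule prob_space_normalized)
  have meets: "measure_support \<nu> \<inter> - nodal_set \<phi> \<psi> \<noteq> {}"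
    using pos nodal_set_closed
    by (intro measure_support_meets[OF \<nu>_sets]) (auto simp: N.emeasure_eq_measure)
  obtain C where C: "C > 0"
    "\<And>p \<sigma> t s. 1 \<le> p \<Longrightarrow> sets \<sigma> = sets borel \<Longrightarrow> finite_measure \<sigma> \<Longrightarrow>
      measure_support \<sigma> \<inter> - nodal_set \<phi> \<psi> \<noteq> {} \<Longrightarrow> t > 6 * t\<^sub>1 \<Longrightarrow> t\<^sub>1 \<le> s \<Longrightarrow> s \<le> t / 2 \<Longrightarrow>
      ergodic_deviation \<mu> u p \<sigma> t ?m
        \<le> ereal (C * exp (- \<gamma> * (t - s))
            * (exp (lam * s) * (\<integral>x. sg_cont \<mu> u s (\<lambda>_. 1) x \<partial>\<sigma>) / (\<integral>x. \<phi> x \<partial>\<sigma>)))"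
    using ergodic_deviation_bound by blast
  define R where "R = exp (lam * t\<^sub>1) * (\<integral>x. sg_cont \<mu> u t\<^sub>1 (\<lambda>_. 1) x \<partial>\<nu>) / (\<integral>x. \<phi> x \<partial>\<nu>)"
  show ?thesis
  proof (rule measure_eqI)
    show "sets \<nu> = sets ?m"
      by (simp add: \<nu>_sets sets_normalized)
    fix A assume "A \<in> sets \<nu>"
    then have A: "A \<in> sets \<mu>" "A \<in> sets \<nu>" "A \<in> sets ?m"
      by (auto simp: \<nu>_sets sets_normalized sets_eq)
    define f where "f = (\<lambda>x. complex_of_real (indicator A x))"
    have f_meas: "f \<in> borel_measurable \<mu>"
      unfolding f_def using A(1) by measurable
    have f_le: "norm (f x) \<le> 1" for x
      by (auto simp: f_def split: split_indicator)
    have f: "f \<in> Lp \<mu> \<infinity>" "Lp_norm \<mu> \<infinity> f \<le> 1"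
      using bounded_in_Lp_unit_balls(2)[OF f_meas f_le] f_meas f_le
      unfolding Lp_infinity_iff by (auto intro!: exI[of _ 1])
    have int_f: "(\<integral>x. f x \<partial>\<nu>) = complex_of_real (measure \<nu> A)" "(\<integral>x. f x \<partial>?m) = complex_of_real (measure ?m A)"
      using A by (auto simp: f_def)
    define \<delta> where "\<delta> = \<bar>measure \<nu> A - measure ?m A\<bar>"
    have "\<delta> \<le> C * exp (- \<gamma> * (t - t\<^sub>1)) * R" if t: "t > 6 * t\<^sub>1" for t
    proof -
      have t': "t > 0" "t\<^sub>1 \<le> t / 2"
        using t t1_pos by auto
      have "ereal (cmod ((\<integral>x. sg_cont \<mu> u t f x \<partial>\<nu>) / complex_of_real (\<integral>x. sg_cont \<mu> u t (\<lambda>_. 1) x \<partial>\<nu>) - (\<integral>x. f x \<partial>?m)))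
          \<le> ergodic_deviation \<mu> u \<infinity> \<nu> t ?m"
        unfolding ergodic_deviation_def using f by (intro SUP_upper) auto
      also have "\<dots> \<le> ereal (C * exp (- \<gamma> * (t - t\<^sub>1)) * R)"
        unfolding R_def using C(2)[OF _ \<nu>_sets N.finite_measure_axioms meets t order_refl t'(2), of \<infinity>] by simp
      also have "(\<integral>x. sg_cont \<mu> u t f x \<partial>\<nu>) / complex_of_real (\<integral>x. sg_cont \<mu> u t (\<lambda>_. 1) x \<partial>\<nu>) = (\<integral>x. f x \<partial>\<nu>)"
        using \<nu> f(1) t'(1) unfolding quasi_stationary_def by blast
      finally have "cmod (complex_of_real (measure \<nu> A - measure ?m A)) \<le> C * exp (- \<gamma> * (t - t\<^sub>1)) * R"
        by (simp add: int_f)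
      then show ?thesis
        unfolding norm_of_real \<delta>_def .
    qed
    then have "\<forall>\<^sub>F t in at_top. \<delta> \<le> C * exp (- \<gamma> * (t - t\<^sub>1)) * R"
      by (rule eventually_mono[OF eventually_gt_at_top[of "6 * t\<^sub>1"]])
    moreover have "((\<lambda>t. C * exp (- \<gamma> * (t - t\<^sub>1)) * R) \<longlongrightarrow> 0) at_top"
      using \<gamma>_pos by real_asymp
    ultimately have "\<delta> \<le> 0"
      by (intro tendsto_lowerbound[of _ 0 at_top]) auto
    then show "emeasure \<nu> A = emeasure ?m A"
      by (simp add: \<delta>_def N.emeasure_eq_measure m.emeasure_eq_measure)
  qed
qed

end

theorem theorem3p4:
  fixes \<mu> :: "'a::polish_space measure"
    and u :: "real \<Rightarrow> 'a \<Rightarrow> 'a \<Rightarrow> real"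
    and t\<^sub>0 t\<^sub>1 lam\<^sub>0 \<gamma> :: real
    and \<phi>\<^sub>0 \<psi>\<^sub>0 :: "'a \<Rightarrow> real"
    and m m' :: "'a measure"
  assumes "locally_compact_space (euclidean :: 'a topology)"
    and "sets \<mu> = sets borel"
    and "locally_finite_measure \<mu>"
    and "measure_support \<mu> = UNIV"
    and "\<And>t. t > 0 \<Longrightarrow> (\<lambda>(x, y). u t x y) \<in> borel_measurable (\<mu> \<Otimes>\<^sub>M \<mu>)"
    and "L2_semigroup \<mu> u"
    and "strongly_continuous \<mu> u"
    and "positivity_preserving \<mu> u"
    and "L2_semigroup \<mu> (transposed u)"
    and "adjoint_semigroups \<mu> u (transposed u)"
    and "t\<^sub>0 > 0"
    and "\<And>t. t > 0 \<Longrightarrow> compact_on_L2 \<mu> (sg \<mu> u t)"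
    and "positivity_improving \<mu> (sg \<mu> u t\<^sub>0)"
    and "strong_Feller \<mu> u"
    and "strong_Feller \<mu> (transposed u)"
    and "bounded_L2_Linfty \<mu> (sg \<mu> u t\<^sub>0)"
    and "bounded_L2_Linfty \<mu> (sg \<mu> (transposed u) t\<^sub>0)"
    and "ereal lam\<^sub>0 = spectral_bottom \<mu> u"
    and "ereal lam\<^sub>0 = spectral_bottom \<mu> (transposed u)"
    and "ground_state \<mu> u lam\<^sub>0 \<phi>\<^sub>0"
    and "ground_state \<mu> (transposed u) lam\<^sub>0 \<psi>\<^sub>0"
    and "\<gamma> > 0"
    and "kernel_convergence_rate \<mu> u t\<^sub>0 lam\<^sub>0 \<phi>\<^sub>0 \<psi>\<^sub>0 \<gamma>"
    and "t\<^sub>1 \<ge> t\<^sub>0"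
    and "heat_content \<mu> u t\<^sub>1 < \<infinity>"
    and m_def: "m = normalized_measure \<mu> \<psi>\<^sub>0"
    and m'_def: "m' = normalized_measure \<mu> \<phi>\<^sub>0"
  shows "(\<phi>\<^sub>0 \<in> Lp \<mu> 1 \<and> \<psi>\<^sub>0 \<in> Lp \<mu> 1 \<and> prob_space m \<and> prob_space m') \<and>
    (\<forall>p::ennreal. 1 \<le> p \<longrightarrow> (\<exists>C::real. C > 0 \<and>
      (\<forall>\<sigma> :: 'a measure. sets \<sigma> = sets borel \<longrightarrow> finite_measure \<sigma> \<longrightarrow>
        measure_support \<sigma> \<inter> (- nodal_set \<phi>\<^sub>0 \<psi>\<^sub>0) \<noteq> {} \<longrightarrow>
        (\<forall>t s. t > 6 * t\<^sub>1 \<longrightarrow> t\<^sub>1 \<le> s \<longrightarrow> s \<le> t / 2 \<longrightarrow>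
          ergodic_deviation \<mu> u p \<sigma> t m
            \<le> ereal (C * exp (- \<gamma> * (t - s))
                * (exp (lam\<^sub>0 * s) * (\<integral>x. sg_cont \<mu> u s (\<lambda>_. 1) x \<partial>\<sigma>) / (\<integral>x. \<phi>\<^sub>0 x \<partial>\<sigma>))) \<and>
          ergodic_deviation \<mu> (transposed u) p \<sigma> t m'
            \<le> ereal (C * exp (- \<gamma> * (t - s))
                * (exp (lam\<^sub>0 * s) * (\<integral>x. sg_cont \<mu> (transposed u) s (\<lambda>_. 1) x \<partial>\<sigma>)
                    / (\<integral>x. \<psi>\<^sub>0 x \<partial>\<sigma>))))))) \<and>
    (quasi_stationary \<mu> u m \<and> quasi_stationary \<mu> (transposed u) m' \<and>
      measure m (- nodal_set \<phi>\<^sub>0 \<psi>\<^sub>0) * measure m' (- nodal_set \<phi>\<^sub>0 \<psi>\<^sub>0) > 0 \<and>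
      (\<forall>\<nu> \<nu>' :: 'a measure. quasi_stationary \<mu> u \<nu> \<longrightarrow> quasi_stationary \<mu> (transposed u) \<nu>' \<longrightarrow>
        measure \<nu> (- nodal_set \<phi>\<^sub>0 \<psi>\<^sub>0) * measure \<nu>' (- nodal_set \<phi>\<^sub>0 \<psi>\<^sub>0) > 0 \<longrightarrow>
        \<nu> = m \<and> \<nu>' = m'))"
proof -
  let ?v = "transposed u"
  interpret full_support_measure \<mu>
    using assms(2-4) by unfold_locales
  have nonneg: "AE x in \<mu>. AE y in \<mu>. 0 \<le> u t x y" if t: "t > 0" for t
  proof (rule kernel_nonneg_AE)
    have "AE x in \<mu>. integrable \<mu> (\<lambda>y. u t x y *\<^sub>R (1 :: complex))"
      using assms(14)[unfolded strong_Feller_def, rule_format, OF t one_in_Lp_infinity]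
      unfolding kernel_op_exists_def by (rule conjunct1)
    then show "AE x in \<mu>. integrable \<mu> (u t x)"
    proof eventually_elim
      case (elim x)
      then have "integrable \<mu> (\<lambda>y. Re (u t x y *\<^sub>R (1 :: complex)))"
        by (rule integrable_Re)
      then show ?case
        by simp
    qed
    fix A assume A: "A \<in> sets \<mu>" "emeasure \<mu> A < \<infinity>"
    have "(indicator A :: 'a \<Rightarrow> real) \<in> Lp \<mu> 2"
      by (rule bounded_finite_support_in_L2[OF _ A, of _ 1]) (use A in auto)
    moreover have "AE x in \<mu>. 0 \<le> (indicator A x :: real)"
      by simp
    ultimately have "AE x in \<mu>. 0 \<le> sg \<mu> u t (indicator A :: 'a \<Rightarrow> real) x"
      by (rule assms(8)[unfolded positivity_preserving_def, rule_format, OF t])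
    then show "AE x in \<mu>. 0 \<le> (\<integral>y. indicator A y * u t x y \<partial>\<mu>)"
      using t by (simp add: sg_def kernel_op_def mult.commute)
  qed
  have meas_t: "(\<lambda>(x, y). ?v t x y) \<in> borel_measurable (\<mu> \<Otimes>\<^sub>M \<mu>)" if "t > 0" for t
    using measurable_pair_swap[OF assms(5)[OF that]] by (simp add: transposed_def)
  have nonneg_t: "AE x in \<mu>. AE y in \<mu>. 0 \<le> ?v t x y" if t: "t > 0" for t
  proof -
    interpret pair_sigma_finite \<mu> \<mu> by (rule pair_sigma_finite)
    have [measurable]: "(\<lambda>p. u t (fst p) (snd p)) \<in> borel_measurable (\<mu> \<Otimes>\<^sub>M \<mu>)"
      using assms(5)[OF t] by (simp add: split_beta')
    show ?thesis
      using nonneg[OF t] unfolding transposed_def by (subst (asm) AE_commute) auto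
  qed
  have L2: "\<phi>\<^sub>0 \<in> Lp \<mu> 2" "\<psi>\<^sub>0 \<in> Lp \<mu> 2"
    using assms(20,21) continuous_measurable[of \<phi>\<^sub>0] continuous_measurable[of \<psi>\<^sub>0]
    by (auto simp: ground_state_def Lp_def)
  interpret G: finite_heat_kernel \<mu> u t\<^sub>0 lam\<^sub>0 \<gamma> \<phi>\<^sub>0 \<psi>\<^sub>0 t\<^sub>1
    by unfold_locales (use assms(5-25) nonneg meas_t nonneg_t L2 in \<open>simp_all add: ground_state_def\<close>)
  interpret D: finite_heat_kernel \<mu> ?v t\<^sub>0 lam\<^sub>0 \<gamma> \<psi>\<^sub>0 \<phi>\<^sub>0 t\<^sub>1
    by (rule G.dual_heat)
  have nodal_swap: "nodal_set \<psi>\<^sub>0 \<phi>\<^sub>0 = nodal_set \<phi>\<^sub>0 \<psi>\<^sub>0"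
    by (auto simp: nodal_set_def)
  have L1: "f \<in> Lp \<mu> 1" if "integrable \<mu> f" for f :: "'a \<Rightarrow> real"
    using that by (simp add: Lp_def Lp_norm_def Let_def integrable_iff_bounded less_top)
  obtain C where C: "C > 0"
    "\<And>p \<sigma> t s. 1 \<le> p \<Longrightarrow> sets \<sigma> = sets borel \<Longrightarrow> finite_measure \<sigma> \<Longrightarrow>
      measure_support \<sigma> \<inter> - nodal_set \<phi>\<^sub>0 \<psi>\<^sub>0 \<noteq> {} \<Longrightarrow> t > 6 * t\<^sub>1 \<Longrightarrow> t\<^sub>1 \<le> s \<Longrightarrow> s \<le> t / 2 \<Longrightarrow>
      ergodic_deviation \<mu> u p \<sigma> t m
        \<le> ereal (C * exp (- \<gamma> * (t - s))
            * (exp (lam\<^sub>0 * s) * (\<integral>x. sg_cont \<mu> u s (\<lambda>_. 1) x \<partial>\<sigma>) / (\<integral>x. \<phi>\<^sub>0 x \<partial>\<sigma>)))"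
    using G.ergodic_deviation_bound unfolding m_def by blast
  obtain C' where C': "C' > 0"
    "\<And>p \<sigma> t s. 1 \<le> p \<Longrightarrow> sets \<sigma> = sets borel \<Longrightarrow> finite_measure \<sigma> \<Longrightarrow>
      measure_support \<sigma> \<inter> - nodal_set \<phi>\<^sub>0 \<psi>\<^sub>0 \<noteq> {} \<Longrightarrow> t > 6 * t\<^sub>1 \<Longrightarrow> t\<^sub>1 \<le> s \<Longrightarrow> s \<le> t / 2 \<Longrightarrow>
      ergodic_deviation \<mu> ?v p \<sigma> t m'
        \<le> ereal (C' * exp (- \<gamma> * (t - s))
            * (exp (lam\<^sub>0 * s) * (\<integral>x. sg_cont \<mu> ?v s (\<lambda>_. 1) x \<partial>\<sigma>) / (\<integral>x. \<psi>\<^sub>0 x \<partial>\<sigma>)))"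
    using D.ergodic_deviation_bound unfolding m'_def nodal_swap by blast
  \<comment> \<open>The larger of the two constants serves both estimates, whose right-hand sides are nonnegative multiples of it.\<close>
  have weaken: "c * exp (- \<gamma> * (t - s)) * r \<le> max C C' * exp (- \<gamma> * (t - s)) * r"
    if "c \<le> max C C'" "0 \<le> r" for c t s r :: real
    using that by (intro mult_right_mono) auto
  have ratio: "0 \<le> exp (lam\<^sub>0 * s) * (\<integral>x. sg_cont \<mu> u s (\<lambda>_. 1) x \<partial>\<sigma>) / (\<integral>x. \<phi>\<^sub>0 x \<partial>\<sigma>)"
    "0 \<le> exp (lam\<^sub>0 * s) * (\<integral>x. sg_cont \<mu> ?v s (\<lambda>_. 1) x \<partial>\<sigma>) / (\<integral>x. \<psi>\<^sub>0 x \<partial>\<sigma>)"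
    if "t\<^sub>1 \<le> s" for s and \<sigma> :: "'a measure"
    using that G.t1_pos G.mass_cont_nonneg[of s] D.mass_cont_nonneg[of s] G.\<phi>_nonneg G.\<psi>_nonneg
    by (auto intro!: mult_nonneg_nonneg divide_nonneg_nonneg integral_nonneg_AE)
  show ?thesis
  proof (intro conjI allI impI)
    show "\<phi>\<^sub>0 \<in> Lp \<mu> 1" "\<psi>\<^sub>0 \<in> Lp \<mu> 1"
      using L1 G.\<phi>_integrable G.\<psi>_integrable by auto
    show "prob_space m" "prob_space m'"
      unfolding m_def m'_def by (rule G.prob_space_normalized D.prob_space_normalized)+
    show "quasi_stationary \<mu> u m" "quasi_stationary \<mu> ?v m'"
      unfolding m_def m'_def by (rule G.quasi_stationary_normalized D.quasi_stationary_normalized)+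
    show "0 < measure m (- nodal_set \<phi>\<^sub>0 \<psi>\<^sub>0) * measure m' (- nodal_set \<phi>\<^sub>0 \<psi>\<^sub>0)"
      using G.measure_normalized_off_nodal_set D.measure_normalized_off_nodal_set
      by (simp add: m_def m'_def nodal_swap)
  next
    fix p :: ennreal assume p: "1 \<le> p"
    show "\<exists>C>0. \<forall>\<sigma>. sets \<sigma> = sets borel \<longrightarrow> finite_measure \<sigma> \<longrightarrow>
        measure_support \<sigma> \<inter> - nodal_set \<phi>\<^sub>0 \<psi>\<^sub>0 \<noteq> {} \<longrightarrow>
        (\<forall>t s. t > 6 * t\<^sub>1 \<longrightarrow> t\<^sub>1 \<le> s \<longrightarrow> s \<le> t / 2 \<longrightarrow>
          ergodic_deviation \<mu> u p \<sigma> t m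
            \<le> ereal (C * exp (- \<gamma> * (t - s))
                * (exp (lam\<^sub>0 * s) * (\<integral>x. sg_cont \<mu> u s (\<lambda>_. 1) x \<partial>\<sigma>) / (\<integral>x. \<phi>\<^sub>0 x \<partial>\<sigma>))) \<and>
          ergodic_deviation \<mu> ?v p \<sigma> t m'
            \<le> ereal (C * exp (- \<gamma> * (t - s))
                * (exp (lam\<^sub>0 * s) * (\<integral>x. sg_cont \<mu> ?v s (\<lambda>_. 1) x \<partial>\<sigma>)
                    / (\<integral>x. \<psi>\<^sub>0 x \<partial>\<sigma>))))"
    proof (rule exI[of _ "max C C'"], intro conjI allI impI)
      show "0 < max C C'"
        using C(1) by simp
      fix \<sigma> :: "'a measure" and t s :: real
      assume *: "sets \<sigma> = sets borel" "finite_measure \<sigma>"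
        "measure_support \<sigma> \<inter> - nodal_set \<phi>\<^sub>0 \<psi>\<^sub>0 \<noteq> {}" "t > 6 * t\<^sub>1" "t\<^sub>1 \<le> s" "s \<le> t / 2"
      show "ergodic_deviation \<mu> u p \<sigma> t m
          \<le> ereal (max C C' * exp (- \<gamma> * (t - s))
              * (exp (lam\<^sub>0 * s) * (\<integral>x. sg_cont \<mu> u s (\<lambda>_. 1) x \<partial>\<sigma>) / (\<integral>x. \<phi>\<^sub>0 x \<partial>\<sigma>)))"
        by (rule order_trans[OF C(2)[OF p *]], unfold ereal_less_eq, rule weaken)
          (use ratio(1)[OF *(5)] in simp_all)
      show "ergodic_deviation \<mu> ?v p \<sigma> t m'
          \<le> ereal (max C C' * exp (- \<gamma> * (t - s))
              * (exp (lam\<^sub>0 * s) * (\<integral>x. sg_cont \<mu> ?v s (\<lambda>_. 1) x \<partial>\<sigma>) / (\<integral>x. \<psi>\<^sub>0 x \<partial>\<sigma>)))"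
        by (rule order_trans[OF C'(2)[OF p *]], unfold ereal_less_eq, rule weaken)
          (use ratio(2)[OF *(5)] in simp_all)
    qed
  next
    fix \<nu> \<nu>' :: "'a measure"
    assume \<nu>: "quasi_stationary \<mu> u \<nu>" "quasi_stationary \<mu> ?v \<nu>'"
      and pos: "0 < measure \<nu> (- nodal_set \<phi>\<^sub>0 \<psi>\<^sub>0) * measure \<nu>' (- nodal_set \<phi>\<^sub>0 \<psi>\<^sub>0)"
    have pos': "0 < measure \<nu> (- nodal_set \<phi>\<^sub>0 \<psi>\<^sub>0)" "0 < measure \<nu>' (- nodal_set \<psi>\<^sub>0 \<phi>\<^sub>0)"
      using pos by (auto simp: zero_less_mult_iff nodal_swap not_less[THEN iffD2, OF measure_nonneg])
    show "\<nu> = m" "\<nu>' = m'"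
      unfolding m_def m'_def
      using G.quasi_stationary_unique[OF \<nu>(1) pos'(1)] D.quasi_stationary_unique[OF \<nu>(2) pos'(2)] by auto
  qed
qed

end
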